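(* Let $N\geq 2$, $1<p<N$, $m,q>0$, $0\leq\alpha<p-1$, $0\leq\beta\leq m$ and assume $\delta:=(p-1-\alpha)(p-1-\beta)-qm>0$. Then for any $a>0$ and $b>0$ there exists a unique non-constant global positive radial solution $(u,v)$ of $$\Delta_p u=v^{m}|\nabla u|^{\alpha},\qquad \Delta_p v=v^{\beta}|\nabla u|^{q}\qquad\text{in }\mathbb{R}^N$$ such that $u(0)=a$ and $v(0)=b$.
   Context: $\Delta_p u=\mathrm{div}(|\nabla u|^{p-2}\nabla u)$ is the $p$-Laplace operator. A non-constant global positive radial solution of the system is a pair $(u,v)$ such that $u,v\in C^2(\mathbb{R}^N)$ are positive and radially symmetric, $u$ and $v$ are not constant in any neighbourhood of the origin, and $u,v$ satisfy the system in all of $\mathbb{R}^N$.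
   Formalization: As C^2(R^N) solutions need not exist when p>2 (e.g. α=0), existence and uniqueness are stated in C^1(R^N)∩C^2(R^N∖{0}) for all parameters, and in C^2(R^N) when p-2≤α and (p-2)(p-1-α)≤q, exactly the range where the solution is C^2. *)

theory Defs
  imports "HOL-Analysis.Analysis"
begin

definition grad :: "(real^'n \<Rightarrow> real) \<Rightarrow> real^'n \<Rightarrow> real^'n" where
  "grad f x = (\<chi> i. frechet_derivative f (at x) (axis i 1))"

definition divergence :: "(real^'n \<Rightarrow> real^'n) \<Rightarrow> real^'n \<Rightarrow> real" where
  "divergence F x = (\<Sum>i\<in>UNIV. frechet_derivative F (at x) (axis i 1) $ i)"

text \<open>\<open>C\<^sup>1\<close> and \<open>C\<^sup>2\<close> regularity; only meaningful for an open set \<open>S\<close>, since derivatives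
  are taken in the full neighbourhood of each point.\<close>

definition C1_on :: "(real^'n) set \<Rightarrow> (real^'n \<Rightarrow> real) \<Rightarrow> bool" where
  "C1_on S f \<longleftrightarrow> (\<forall>x\<in>S. f differentiable (at x)) \<and> continuous_on S (grad f)"

definition C2_on :: "(real^'n) set \<Rightarrow> (real^'n \<Rightarrow> real) \<Rightarrow> bool" where
  "C2_on S f \<longleftrightarrow> C1_on S f \<and> (\<forall>i. C1_on S (\<lambda>x. grad f x $ i))"

text \<open>Where the gradient vanishes the flux is 0, also for \<open>p < 2\<close>: the factor
  \<open>0 powr (p - 2) = 0\<close> multiplies the zero vector.\<close>

definition p_flux :: "real \<Rightarrow> (real^'n \<Rightarrow> real) \<Rightarrow> real^'n \<Rightarrow> real^'n" where
  "p_flux p u x = (norm (grad u x) powr (p - 2)) *\<^sub>R grad u x"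

definition p_laplace :: "real \<Rightarrow> (real^'n \<Rightarrow> real) \<Rightarrow> real^'n \<Rightarrow> real" where
  "p_laplace p u x = divergence (p_flux p u) x"

text \<open>Powers of nonnegative reals with \<open>0\<^sup>0 = 1\<close>, whereas \<open>0 powr 0 = 0\<close>. With exponent
  \<open>\<alpha> = 0\<close> the factor \<open>\<bar>\<nabla>u\<bar>\<^sup>\<alpha>\<close> must be absent even at critical points of \<open>u\<close>.\<close>

definition rpow :: "real \<Rightarrow> real \<Rightarrow> real" where
  "rpow t s = (if s = 0 then 1 else t powr s)"

text \<open>Both equations hold classically at every point, the origin included; as the value of
  \<^const>\<open>frechet_derivative\<close> is arbitrary where there is no derivative, differentiability of the
  fluxes is demanded explicitly.\<close>

definition satisfies_system ::
  "real \<Rightarrow> real \<Rightarrow> real \<Rightarrow> real \<Rightarrow> real \<Rightarrow> (real^'n \<Rightarrow> real) \<Rightarrow> (real^'n \<Rightarrow> real) \<Rightarrow> bool" where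
  "satisfies_system p m q \<alpha> \<beta> u v \<longleftrightarrow>
     (\<forall>x. p_flux p u differentiable (at x) \<and> p_flux p v differentiable (at x) \<and>
          p_laplace p u x = rpow (v x) m * rpow (norm (grad u x)) \<alpha> \<and>
          p_laplace p v x = rpow (v x) \<beta> * rpow (norm (grad u x)) q)"

definition radially_symmetric :: "(real^'n \<Rightarrow> real) \<Rightarrow> bool" where
  "radially_symmetric f \<longleftrightarrow> (\<forall>x y. norm x = norm y \<longrightarrow> f x = f y)"

definition nonconstant_near_0 :: "(real^'n \<Rightarrow> real) \<Rightarrow> bool" where
  "nonconstant_near_0 f \<longleftrightarrow> (\<forall>U. open U \<and> 0 \<in> U \<longrightarrow> \<not> f constant_on U)"

text \<open>Everything in the notion of a non-constant global positive radial solution except the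
  regularity class.\<close>

definition nonconst_pos_radial_system ::
  "real \<Rightarrow> real \<Rightarrow> real \<Rightarrow> real \<Rightarrow> real \<Rightarrow> (real^'n \<Rightarrow> real) \<Rightarrow> (real^'n \<Rightarrow> real) \<Rightarrow> bool" where
  "nonconst_pos_radial_system p m q \<alpha> \<beta> u v \<longleftrightarrow>
     (\<forall>x. u x > 0) \<and> (\<forall>x. v x > 0) \<and>
     radially_symmetric u \<and> radially_symmetric v \<and>
     nonconstant_near_0 u \<and> nonconstant_near_0 v \<and>
     satisfies_system p m q \<alpha> \<beta> u v"

text \<open>The \<open>C\<^sup>2(\<real>\<^sup>N)\<close> notion.\<close>

definition C2_radial_solution ::
  "real \<Rightarrow> real \<Rightarrow> real \<Rightarrow> real \<Rightarrow> real \<Rightarrow> (real^'n \<Rightarrow> real) \<Rightarrow> (real^'n \<Rightarrow> real) \<Rightarrow> bool" where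
  "C2_radial_solution p m q \<alpha> \<beta> u v \<longleftrightarrow>
     C2_on UNIV u \<and> C2_on UNIV v \<and> nonconst_pos_radial_system p m q \<alpha> \<beta> u v"

text \<open>The same with \<open>C\<^sup>2(\<real>\<^sup>N)\<close> relaxed to \<open>C\<^sup>1(\<real>\<^sup>N) \<inter> C\<^sup>2(\<real>\<^sup>N - {0})\<close>. A non-constant radial
  solution behaves near the origin like \<open>\<bar>\<nabla>u\<bar> \<sim> c r powr g\<close> with \<open>g = 1 / (p - 1 - \<alpha>)\<close> and
  \<open>\<bar>\<nabla>v\<bar> \<sim> d r powr h\<close> with \<open>h = (1 + q * g) / (p - 1)\<close>, where \<open>c, d > 0\<close>. So it is twice
  differentiable at 0 only if \<open>g \<ge> 1\<close> and \<open>h \<ge> 1\<close>, i.e. \<open>p - 2 \<le> \<alpha>\<close> and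
  \<open>(p - 2) * (p - 1 - \<alpha>) \<le> q\<close>, which is automatic for \<open>p \<le> 2\<close> but not for \<open>p > 2\<close>.\<close>

definition radial_solution ::
  "real \<Rightarrow> real \<Rightarrow> real \<Rightarrow> real \<Rightarrow> real \<Rightarrow> (real^'n \<Rightarrow> real) \<Rightarrow> (real^'n \<Rightarrow> real) \<Rightarrow> bool" where
  "radial_solution p m q \<alpha> \<beta> u v \<longleftrightarrow>
     C1_on UNIV u \<and> C1_on UNIV v \<and> C2_on (- {0}) u \<and> C2_on (- {0}) v \<and>
     nonconst_pos_radial_system p m q \<alpha> \<beta> u v"

end

theory Submission
  imports Defs
begin

text \<open>Put \<open>r = \<bar>x\<bar>\<close>, \<open>\<nu> = N - 1\<close>, and write \<open>w\<close> and \<open>z\<close> for the radial derivatives of \<open>u\<close> and \<open>v\<close>. For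
  radial functions the system reads
  \<open>(r\<^sup>\<nu> \<bar>w\<bar>\<^sup>p\<^sup>-\<^sup>2 w)' = r\<^sup>\<nu> v\<^sup>m \<bar>w\<bar>\<^sup>\<alpha>\<close> and \<open>(r\<^sup>\<nu> \<bar>z\<bar>\<^sup>p\<^sup>-\<^sup>2 z)' = r\<^sup>\<nu> v\<^sup>\<beta> \<bar>w\<bar>\<^sup>q\<close>.
  The fluxes on the left increase from zero, so \<open>w\<close> and \<open>z\<close> are nonnegative, and for a solution that is
  not constant near the origin \<open>w > 0\<close> for all \<open>r > 0\<close> (\<open>flux_monotone\<close>). The first equation can then
  be divided by \<open>w\<^sup>\<alpha>\<close> and integrated: with \<open>\<theta> = (p - 1 - \<alpha>) / (p - 1)\<close> and \<open>\<kappa> = \<nu> \<theta>\<close>, the power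
  \<open>w\<^sup>p\<^sup>-\<^sup>1\<^sup>-\<^sup>\<alpha>\<close> is \<open>r\<^sup>-\<^sup>\<kappa>\<close> times the integral of \<open>s\<^sup>\<kappa> \<theta> v\<^sup>m\<close> over \<open>[0, r]\<close>. Hence \<open>w\<close> is an explicit
  function of \<open>v\<close>, and inserting it into the integrated second equation shows that \<open>v\<close> is a fixed
  point of an integral operator \<open>T v = b + S v\<close> (\<open>solution_imp_fixed_point\<close>).

  The map \<open>S\<close> preserves order and is positively homogeneous of degree
  \<open>\<sigma> = (\<beta> + m q / (p - 1 - \<alpha>)) / (p - 1)\<close>, and the assumption \<open>\<delta> > 0\<close> says exactly that \<open>\<sigma> < 1\<close>. If
  \<open>V \<le> c W\<close> with \<open>c \<ge> 1\<close> then \<open>T V \<le> c\<^sup>\<sigma> T W\<close>; so \<open>T\<close> contracts the distance \<open>sup \<bar>ln V - ln W\<bar>\<close> by the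
  factor \<open>\<sigma>\<close>, on every interval \<open>[0, R]\<close> (\<open>integral_op_contraction\<close>). Banach's fixed point theorem
  therefore gives existence, uniqueness and globality together (\<open>fixed_point_unique\<close>,
  \<open>fixed_point_global\<close>).

  It remains to see that the fixed point gives a solution (\<open>fixed_point_imp_solution\<close>). Away from the
  origin this is differentiation. At the origin, \<open>w\<close>, \<open>z\<close> and the fluxes are powers of weighted means,
  whose order of vanishing is known (\<open>wmean_powr_asymp\<close>). If such a function vanishes to the order at
  least one, the radial field that it defines is differentiable at the origin. This holds for
  both fluxes always, and for \<open>w\<close> and \<open>z\<close>, which is what second-order regularity of \<open>u\<close> and \<open>v\<close>
  requires, under the extra conditions of the second claim.\<close>

section \<open>Calculus on the half-line\<close>

lemma has_real_derivative_integral_from_0: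
  fixes h :: "real \<Rightarrow> real"
  assumes h: "continuous_on {0..} h" and "0 \<le> r"
  shows "((\<lambda>t. integral {0..t} h) has_real_derivative h r) (at r within {0..})"
proof -
  have "at r within {0..} = at r within {0..r+1}"
    by (rule at_within_nhd[where S="{..<r+1}"]) auto
  moreover have "((\<lambda>t. integral {0..t} h) has_real_derivative h r) (at r within {0..r+1})"
    using assms by (intro integral_has_real_derivative) (auto intro: continuous_on_subset)
  ultimately show ?thesis by simp
qed

lemma at_within_atLeast_0: "0 < r \<Longrightarrow> at r within {0..} = at (r::real)"
  by (rule at_within_nhd[where S="{0<..}"]) auto

lemma continuous_on_integral_from_0:
  fixes h :: "real \<Rightarrow> real"
  assumes "continuous_on {0..} h"
  shows "continuous_on {0..} (\<lambda>t. integral {0..t} h)"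
  using has_real_derivative_integral_from_0[OF assms] by (intro DERIV_continuous_on) auto

lemma eq_integral_from_0:
  fixes F h :: "real \<Rightarrow> real"
  assumes F: "continuous_on {0..} F"
    and deriv: "\<And>t. 0 < t \<Longrightarrow> (F has_real_derivative h t) (at t)" and r: "0 \<le> r"
  shows "F r = F 0 + integral {0..r} h"
proof -
  have "(h has_integral (F r - F 0)) {0..r}"
    using r deriv
    by (intro fundamental_theorem_of_calculus_interior continuous_on_subset[OF F])
      (auto simp: has_real_derivative_iff_has_vector_derivative)
  then show ?thesis by (simp add: integral_unique)
qed

lemma integral_from_0_pos:
  fixes h :: "real \<Rightarrow> real"
  assumes h: "continuous_on {0..} h" and pos: "\<And>t. 0 < t \<Longrightarrow> 0 < h t" and r: "0 < r"
  shows "0 < integral {0..r} h"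
proof -
  have "integral {0..0} h < integral {0..r} h"
  proof (rule DERIV_pos_imp_increasing_open[OF r])
    fix t :: real assume t: "0 < t" "t < r"
    show "\<exists>y. ((\<lambda>r. integral {0..r} h) has_real_derivative y) (at t) \<and> 0 < y"
      using has_real_derivative_integral_from_0[OF h, of t] pos[OF t(1)] t
      by (auto simp: at_within_atLeast_0)
  qed (auto intro: continuous_on_subset[OF continuous_on_integral_from_0[OF h]])
  then show ?thesis by simp
qed

section \<open>Weighted means\<close>

text \<open>For \<open>\<kappa> > 0\<close> this is the solution of \<open>y' + \<kappa> y / r = f\<close> that is bounded at the origin, which is the
form that both radial equations take once they are solved for a power of the slope. It equals
\<open>r / (\<kappa> + 1)\<close> times the mean of \<open>f\<close> over \<open>[0, r]\<close> for the weight \<open>s\<^sup>\<kappa>\<close>.\<close>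

definition wmean :: "real \<Rightarrow> (real \<Rightarrow> real) \<Rightarrow> real \<Rightarrow> real" where
  "wmean \<kappa> f r = r powr (-\<kappa>) * integral {0..r} (\<lambda>s. s powr \<kappa> * f s)"

lemma wmean_0 [simp]: "wmean \<kappa> f 0 = 0"
  by (simp add: wmean_def)

context
  fixes \<kappa> :: real
  assumes \<kappa>: "0 < \<kappa>"
begin

lemma continuous_on_weighted:
  "continuous_on {0..} f \<Longrightarrow> continuous_on {0..} (\<lambda>s. s powr \<kappa> * f s)"
  using \<kappa> by (intro continuous_on_mult continuous_on_powr') (auto intro: continuous_intros)

lemma weighted_integrable:
  fixes f :: "real \<Rightarrow> real"
  shows "continuous_on {0..} f \<Longrightarrow> (\<lambda>s. s powr \<kappa> * f s) integrable_on {0..r}"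
  by (rule integrable_continuous_real) (auto intro: continuous_on_subset[OF continuous_on_weighted])

lemma wmean_mono:
  assumes "continuous_on {0..} f" "continuous_on {0..} g" "\<And>s. 0 \<le> s \<Longrightarrow> s \<le> r \<Longrightarrow> f s \<le> g s"
  shows "wmean \<kappa> f r \<le> wmean \<kappa> g r"
  unfolding wmean_def using assms
  by (intro mult_left_mono integral_le weighted_integrable) (auto intro: mult_left_mono)

lemma wmean_cmult: "wmean \<kappa> (\<lambda>s. c * f s) r = c * wmean \<kappa> f r"
  by (simp add: wmean_def mult.left_commute[of _ c])

lemma wmean_nonneg:
  assumes "continuous_on {0..} f" "\<And>s. 0 \<le> s \<Longrightarrow> 0 \<le> f s"
  shows "0 \<le> wmean \<kappa> f r"
  unfolding wmean_def using assms
  by (intro mult_nonneg_nonneg integral_nonneg weighted_integrable) auto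

lemma wmean_pos:
  assumes "continuous_on {0..} f" "\<And>s. 0 < s \<Longrightarrow> 0 < f s" "0 < r"
  shows "0 < wmean \<kappa> f r"
  unfolding wmean_def using assms
  by (intro mult_pos_pos integral_from_0_pos continuous_on_weighted) auto

lemma wmean_has_real_derivative:
  assumes f: "continuous_on {0..} f" and r: "0 < r"
  shows "(wmean \<kappa> f has_real_derivative f r - \<kappa> * (wmean \<kappa> f r / r)) (at r)"
proof -
  have *: "((\<lambda>t. integral {0..t} (\<lambda>s. s powr \<kappa> * f s)) has_real_derivative r powr \<kappa> * f r) (at r)"
    using has_real_derivative_integral_from_0[OF continuous_on_weighted[OF f], of r] r
    by (simp add: at_within_atLeast_0)
  show ?thesis
    unfolding wmean_def
    by (rule derivative_eq_intros * refl | use r in \<open>force simp: powr_minus powr_diff field_simps\<close>)+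
qed

text \<open>By l'Hopital's rule a function of order \<open>r\<^sup>\<gamma>\<close> at the origin has a weighted mean of order
  \<open>r\<^sup>\<gamma>\<^sup>+\<^sup>1\<close>; every statement about behaviour at the origin rests on this.\<close>

lemma wmean_asymp:
  assumes f: "continuous_on {0..} f" and \<gamma>: "0 \<le> \<gamma>"
    and lim: "((\<lambda>r. f r / r powr \<gamma>) \<longlongrightarrow> c) (at_right 0)"
  shows "((\<lambda>r. wmean \<kappa> f r / r powr (\<gamma> + 1)) \<longlongrightarrow> c / (\<kappa> + \<gamma> + 1)) (at_right 0)"
proof -
  let ?I = "\<lambda>r. integral {0..r} (\<lambda>s. s powr \<kappa> * f s)"
  have pos: "\<forall>\<^sub>F r in at_right (0::real). 0 < r"
    by (rule eventually_at_right_less)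
  have "((\<lambda>r. ?I r / r powr (\<kappa> + \<gamma> + 1)) \<longlongrightarrow> c / (\<kappa> + \<gamma> + 1)) (at_right 0)"
  proof (rule lhopital_right_0)
    have "(?I \<longlongrightarrow> ?I 0) (at 0 within {0..})"
      by (rule continuous_on_integral_from_0[OF continuous_on_weighted[OF f],
            unfolded continuous_on_def, rule_format]) simp
    then have "(?I \<longlongrightarrow> ?I 0) (at_right 0)"
      by (rule tendsto_within_subset) auto
    then show "(?I \<longlongrightarrow> 0) (at_right 0)" by simp
    show "((\<lambda>r. r powr (\<kappa> + \<gamma> + 1)) \<longlongrightarrow> 0) (at_right 0)"
      by (rule tendsto_zero_powrI[OF tendsto_ident_at tendsto_const])
        (use \<kappa> \<gamma> eventually_mono[OF pos less_imp_le] in auto)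
    show "\<forall>\<^sub>F r in at_right 0. r powr (\<kappa> + \<gamma> + 1) \<noteq> 0"
      using pos by eventually_elim simp
    show "\<forall>\<^sub>F r in at_right 0. (\<kappa> + \<gamma> + 1) * r powr (\<kappa> + \<gamma>) \<noteq> 0"
      using pos by eventually_elim (use \<kappa> \<gamma> in simp)
    show "\<forall>\<^sub>F r in at_right 0. (?I has_real_derivative r powr \<kappa> * f r) (at r)"
      using pos
    proof eventually_elim
      case (elim r)
      then show ?case
        using has_real_derivative_integral_from_0[OF continuous_on_weighted[OF f], of r]
        by (simp add: at_within_atLeast_0)
    qed
    show "\<forall>\<^sub>F r in at_right 0. ((\<lambda>r. r powr (\<kappa> + \<gamma> + 1)) has_real_derivative
        (\<kappa> + \<gamma> + 1) * r powr (\<kappa> + \<gamma>)) (at r)"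
      using pos
    proof eventually_elim
      case (elim r)
      then show ?case
        using has_real_derivative_powr[of r "\<kappa> + \<gamma> + 1"] by simp
    qed
    have "((\<lambda>r. f r / r powr \<gamma> / (\<kappa> + \<gamma> + 1)) \<longlongrightarrow> c / (\<kappa> + \<gamma> + 1)) (at_right 0)"
      using \<kappa> \<gamma> by (intro tendsto_divide lim tendsto_const) auto
    then show "((\<lambda>r. r powr \<kappa> * f r / ((\<kappa> + \<gamma> + 1) * r powr (\<kappa> + \<gamma>))) \<longlongrightarrow> c / (\<kappa> + \<gamma> + 1))
        (at_right 0)"
      by (rule Lim_transform_eventually)
        (use pos in \<open>eventually_elim, auto simp: powr_add\<close>)
  qed
  then show ?thesis
    by (rule Lim_transform_eventually)
      (use pos in \<open>eventually_elim, auto simp: wmean_def powr_add powr_minus field_simps\<close>)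
qed

lemma continuous_on_wmean:
  assumes f: "continuous_on {0..} f"
  shows "continuous_on {0..} (wmean \<kappa> f)"
proof (rule continuous_on_eq_continuous_within[THEN iffD2], rule ballI)
  fix r :: real assume "r \<in> {0..}"
  then consider "r = 0" | "0 < r" by fastforce
  then show "continuous (at r within {0..}) (wmean \<kappa> f)"
  proof cases
    case 1
    have "(f \<longlongrightarrow> f 0) (at 0 within {0..})"
      using f by (auto simp: continuous_on_def)
    then have f0: "(f \<longlongrightarrow> f 0) (at_right 0)"
      by (rule tendsto_within_subset) auto
    have "((\<lambda>r. f r / r powr 0) \<longlongrightarrow> f 0) (at_right 0)"
      by (rule Lim_transform_eventually[OF f0])
        (use eventually_at_right_less[of 0] in \<open>eventually_elim, auto\<close>)
    from wmean_asymp[OF f _ this]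
    have "((\<lambda>r. r * (wmean \<kappa> f r / r powr 1)) \<longlongrightarrow> 0 * (f 0 / (\<kappa> + 1))) (at_right 0)"
      by (intro tendsto_mult) auto
    then have "(wmean \<kappa> f \<longlongrightarrow> 0) (at_right 0)"
      unfolding mult_zero_left
      by (rule Lim_transform_eventually)
        (use eventually_at_right_less[of 0] in \<open>eventually_elim, auto\<close>)
    moreover have "at_right (0::real) = at 0 within {0..}"
      by (rule at_within_nhd[where S=UNIV]) auto
    ultimately show ?thesis using 1 by (simp add: continuous_within)
  next
    case 2
    then show ?thesis
      using DERIV_isCont[OF wmean_has_real_derivative[OF f 2]]
      by (simp add: at_within_atLeast_0)
  qed
qed

lemma wmean_powr_has_real_derivative:
  assumes f: "continuous_on {0..} f" "\<And>s. 0 < s \<Longrightarrow> 0 < f s" and r: "0 < r"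
  shows "((\<lambda>r. wmean \<kappa> f r powr e) has_real_derivative
     e * wmean \<kappa> f r powr (e - 1) * (f r - \<kappa> * (wmean \<kappa> f r / r))) (at r)"
  using DERIV_chain2[OF has_real_derivative_powr[OF wmean_pos[OF f r]] wmean_has_real_derivative[OF f(1) r]]
  .

lemma continuous_on_wmean_powr_deriv:
  assumes f: "continuous_on {0..} f" "\<And>s. 0 < s \<Longrightarrow> 0 < f s"
  shows "continuous_on {0<..}
     (\<lambda>r. e * wmean \<kappa> f r powr (e - 1) * (f r - \<kappa> * (wmean \<kappa> f r / r)))"
proof -
  have "continuous_on {0<..} f" "continuous_on {0<..} (wmean \<kappa> f)"
    using f(1) continuous_on_wmean[OF f(1)] by (auto intro: continuous_on_subset)
  then show ?thesis
    using wmean_pos[OF f] by (intro continuous_intros) (auto simp: less_imp_neq[symmetric])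
qed

text \<open>The functions \<open>y\<close> below are those that the radial equations produce. The exponent
  \<open>(\<gamma> + 1) * e\<close> is the order at which \<open>y\<close> vanishes at the origin; when it is at least one, the
  difference quotient and the derivative have the same limit there, which is what makes the
  field \<open>y(\<bar>x\<bar>) x/\<bar>x\<bar>\<close> continuously differentiable at the origin.\<close>

lemma wmean_powr_asymp:
  assumes f: "continuous_on {0..} f" "\<And>s. 0 < s \<Longrightarrow> 0 < f s" and \<gamma>: "0 \<le> \<gamma>" and c: "0 < c"
    and lim: "((\<lambda>r. f r / r powr \<gamma>) \<longlongrightarrow> c) (at_right 0)"
    and e: "1 \<le> (\<gamma> + 1) * e"
  defines "y \<equiv> \<lambda>r. wmean \<kappa> f r powr e"
  defines "y' \<equiv> \<lambda>r. e * wmean \<kappa> f r powr (e - 1) * (f r - \<kappa> * (wmean \<kappa> f r / r))"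
  defines "l \<equiv> if (\<gamma> + 1) * e = 1 then (c / (\<kappa> + \<gamma> + 1)) powr e else 0"
  shows "((\<lambda>r. y r / r) \<longlongrightarrow> l) (at_right 0)" and "(y' \<longlongrightarrow> l) (at_right 0)"
proof -
  define h where "h = (\<gamma> + 1) * e"
  define d where "d = c / (\<kappa> + \<gamma> + 1)"
  have d: "0 < d" using c \<kappa> \<gamma> by (simp add: d_def)
  have pos: "\<forall>\<^sub>F r in at_right (0::real). 0 < r"
    by (rule eventually_at_right_less)
  note A = wmean_asymp[OF f(1) \<gamma> lim, folded d_def]
  have power: "((\<lambda>r::real. r powr (h - 1)) \<longlongrightarrow> (if h = 1 then 1 else 0)) (at_right 0)"
  proof (cases "h = 1")
    case True
    have "((\<lambda>r::real. 1) \<longlongrightarrow> 1) (at_right (0::real))" by (rule tendsto_const)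
    then have "((\<lambda>r::real. r powr (h - 1)) \<longlongrightarrow> 1) (at_right 0)"
      by (rule Lim_transform_eventually) (use pos in \<open>eventually_elim, auto simp: True\<close>)
    then show ?thesis using True by simp
  next
    case False
    with e have "0 < h - 1" by (simp add: h_def)
    moreover have "\<forall>\<^sub>F r in at_right (0::real). 0 \<le> r"
      using pos by eventually_elim simp
    ultimately have "((\<lambda>r::real. r powr (h - 1)) \<longlongrightarrow> 0) (at_right 0)"
      by (intro tendsto_zero_powrI[OF _ tendsto_const]) auto
    then show ?thesis using False by simp
  qed
  have "((\<lambda>r. (wmean \<kappa> f r / r powr (\<gamma> + 1)) powr e * r powr (h - 1)) \<longlongrightarrow>
      d powr e * (if h = 1 then 1 else 0)) (at_right 0)"
    using d by (intro tendsto_intros A power) auto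
  moreover have "\<forall>\<^sub>F r in at_right 0.
      (wmean \<kappa> f r / r powr (\<gamma> + 1)) powr e * r powr (h - 1) = y r / r"
    using pos
  proof eventually_elim
    case (elim r)
    then show ?case using wmean_pos[OF f elim]
      by (simp add: y_def powr_divide powr_powr powr_diff h_def)
  qed
  ultimately have "((\<lambda>r. y r / r) \<longlongrightarrow> d powr e * (if h = 1 then 1 else 0)) (at_right 0)"
    by (rule Lim_transform_eventually)
  then show "((\<lambda>r. y r / r) \<longlongrightarrow> l) (at_right 0)"
    by (auto simp: l_def h_def d_def)
  have "((\<lambda>r. e * (wmean \<kappa> f r / r powr (\<gamma> + 1)) powr (e - 1) *
      (f r / r powr \<gamma> - \<kappa> * (wmean \<kappa> f r / r powr (\<gamma> + 1))) * r powr (h - 1)) \<longlongrightarrow>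
      e * d powr (e - 1) * (c - \<kappa> * d) * (if h = 1 then 1 else 0)) (at_right 0)"
    using d by (intro tendsto_intros A power lim) auto
  moreover have "\<forall>\<^sub>F r in at_right 0. e * (wmean \<kappa> f r / r powr (\<gamma> + 1)) powr (e - 1) *
      (f r / r powr \<gamma> - \<kappa> * (wmean \<kappa> f r / r powr (\<gamma> + 1))) * r powr (h - 1) = y' r"
    using pos
  proof eventually_elim
    case (elim r)
    have "h - 1 = (\<gamma> + 1) * (e - 1) + \<gamma>" by (simp add: h_def algebra_simps)
    then have "r powr (h - 1) = r powr ((\<gamma> + 1) * (e - 1)) * r powr \<gamma>"
      by (simp add: powr_add)
    moreover have "(wmean \<kappa> f r / r powr (\<gamma> + 1)) powr (e - 1)
        = wmean \<kappa> f r powr (e - 1) / r powr ((\<gamma> + 1) * (e - 1))"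
      using wmean_pos[OF f elim] by (simp add: powr_divide powr_powr)
    moreover have "(f r / r powr \<gamma> - \<kappa> * (wmean \<kappa> f r / r powr (\<gamma> + 1))) * r powr \<gamma>
        = f r - \<kappa> * (wmean \<kappa> f r / r)"
      using elim by (simp add: powr_add field_simps)
    ultimately show ?case using elim by (simp add: y'_def)
  qed
  ultimately have "(y' \<longlongrightarrow> e * d powr (e - 1) * (c - \<kappa> * d) * (if h = 1 then 1 else 0)) (at_right 0)"
    by (rule Lim_transform_eventually)
  moreover have "e * d powr (e - 1) * (c - \<kappa> * d) = d powr e" if "h = 1"
  proof -
    have "c - \<kappa> * d = (\<gamma> + 1) * d" using \<kappa> \<gamma> by (simp add: d_def field_simps)
    then have "e * d powr (e - 1) * (c - \<kappa> * d) = h * (d powr (e - 1) * d)"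
      by (simp add: h_def)
    also have "d powr (e - 1) * d = d powr e" using d by (simp add: powr_diff)
    finally show ?thesis using that by simp
  qed
  ultimately show "(y' \<longlongrightarrow> l) (at_right 0)"
    by (auto simp: l_def h_def d_def)
qed

end

section \<open>Radial fields\<close>

text \<open>Near the origin the norm is not differentiable, so the chain rule is replaced by this passage from
one-sided limits of a profile to limits of the radial function.\<close>

lemma norm_tendsto_at_right_0: "filterlim (norm :: 'a::real_normed_vector \<Rightarrow> real) (at_right 0) (at 0)"
  by (auto simp: filterlim_at eventually_at_filter intro!: tendsto_eq_intros)

lemma radial_field_has_derivative:
  fixes x :: "'a::euclidean_space"
  assumes x: "x \<noteq> 0" and k: "(k has_real_derivative k') (at (norm x))"
  shows "((\<lambda>y. k (norm y) *\<^sub>R y) has_derivative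
    (\<lambda>h. k (norm x) *\<^sub>R h + (k' * ((x \<bullet> h) / norm x)) *\<^sub>R x)) (at x)"
proof -
  have "((\<lambda>y. k (norm y)) has_derivative (\<lambda>h. k' * (h \<bullet> sgn x))) (at x)"
    using has_derivative_compose[OF has_derivative_norm[OF x], of k "(*) k'"] k
    by (simp add: has_field_derivative_def)
  then have "((\<lambda>y. k (norm y) *\<^sub>R y) has_derivative
      (\<lambda>h. k (norm x) *\<^sub>R h + (k' * (h \<bullet> sgn x)) *\<^sub>R x)) (at x)"
    by (intro has_derivative_scaleR has_derivative_ident)
  moreover have "h \<bullet> sgn x = (x \<bullet> h) / norm x" for h
    by (simp add: sgn_div_norm inner_commute divide_inverse)
  ultimately show ?thesis by simp
qed

lemma radial_field_has_derivative_0: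
  assumes "(k \<longlongrightarrow> L) (at_right 0)"
  shows "((\<lambda>y. k (norm y) *\<^sub>R y) has_derivative (\<lambda>h::'a::real_normed_vector. L *\<^sub>R h)) (at 0)"
  unfolding has_derivative_iff_norm
proof
  have "((\<lambda>y::'a. k (norm y)) \<longlongrightarrow> L) (at 0)"
    by (rule filterlim_compose[OF assms norm_tendsto_at_right_0])
  then have "((\<lambda>y::'a. \<bar>k (norm y) - L\<bar>) \<longlongrightarrow> 0) (at 0)"
    by (simp add: LIM_zero tendsto_rabs_zero)
  then show "((\<lambda>y::'a. norm (k (norm y) *\<^sub>R y - k (norm 0) *\<^sub>R 0 - L *\<^sub>R (y - 0)) / norm (y - 0)) \<longlongrightarrow> 0)
      (at 0)"
    by (rule Lim_transform_eventually)
      (auto simp: eventually_at_filter simp flip: scaleR_left_diff_distrib)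
qed (rule bounded_linear_scaleR_right)

lemma radial_function_has_derivative:
  fixes x :: "'a::euclidean_space"
  assumes x: "x \<noteq> 0" and U: "(U has_real_derivative w) (at (norm x))"
  shows "((\<lambda>y. U (norm y)) has_derivative (\<lambda>h. ((w / norm x) *\<^sub>R x) \<bullet> h)) (at x)"
proof -
  have "((\<lambda>y. U (norm y)) has_derivative (\<lambda>h. w * (h \<bullet> sgn x))) (at x)"
    using has_derivative_compose[OF has_derivative_norm[OF x], of U "(*) w"] U
    by (simp add: has_field_derivative_def)
  moreover have "w * (h \<bullet> sgn x) = ((w / norm x) *\<^sub>R x) \<bullet> h" for h
    by (simp add: sgn_div_norm inner_commute divide_inverse)
  ultimately show ?thesis by simp
qed

lemma radial_function_has_derivative_0:
  assumes U: "(U has_real_derivative 0) (at 0 within {0..})"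
  shows "((\<lambda>y. U (norm y)) has_derivative (\<lambda>h. 0)) (at (0::'a::real_normed_vector))"
  unfolding has_derivative_iff_norm
proof
  have "((\<lambda>r. norm (U r - U 0) / norm r) \<longlongrightarrow> 0) (at 0 within {0..})"
    using U by (simp add: has_field_derivative_def has_derivative_iff_norm)
  then have "((\<lambda>r. norm (U r - U 0) / norm r) \<longlongrightarrow> 0) (at_right 0)"
    by (rule tendsto_within_subset) auto
  from filterlim_compose[OF this norm_tendsto_at_right_0]
  show "((\<lambda>y::'a. norm (U (norm y) - U (norm 0) - 0) / norm (y - 0)) \<longlongrightarrow> 0) (at 0)"
    by simp
qed (rule bounded_linear_zero)

lemma grad_eqI: "(f has_derivative (\<lambda>h. g \<bullet> h)) (at x) \<Longrightarrow> grad f x = g"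
  by (drule frechet_derivative_at[symmetric]) (simp add: grad_def vec_eq_iff inner_axis)

text \<open>The total derivative is recovered from the partial derivatives that define \<^const>\<open>grad\<close>, by
linearity.\<close>

lemma has_derivative_grad:
  assumes "f differentiable (at x)"
  shows "(f has_derivative (\<lambda>h. grad f x \<bullet> h)) (at x)"
proof -
  let ?D = "frechet_derivative f (at x)"
  have D: "(f has_derivative ?D) (at x)" using assms by (simp flip: frechet_derivative_works)
  then have "linear ?D" by (simp add: has_derivative_linear)
  have "?D h = grad f x \<bullet> h" for h
  proof -
    have "?D h = ?D (\<Sum>i\<in>UNIV. (h $ i) *\<^sub>R axis i 1)"
      by (simp add: basis_expansion flip: scalar_mult_eq_scaleR)
    also have "\<dots> = (\<Sum>i\<in>UNIV. (h $ i) *\<^sub>R ?D (axis i 1))"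
      by (simp add: linear_sum[OF \<open>linear ?D\<close>] linear_cmul[OF \<open>linear ?D\<close>])
    finally show ?thesis by (simp add: grad_def inner_vec_def mult.commute)
  qed
  then have "?D = (\<lambda>h. grad f x \<bullet> h)" by auto
  with D show ?thesis by simp
qed

lemma divergence_eqI:
  "(F has_derivative F') (at x) \<Longrightarrow> divergence F x = (\<Sum>i\<in>UNIV. F' (axis i 1) $ i)"
  by (drule frechet_derivative_at[symmetric]) (simp add: divergence_def)

lemma divergence_radial_field:
  fixes x :: "real^'n"
  assumes x: "x \<noteq> 0" and k: "(k has_real_derivative k') (at (norm x))"
  shows "divergence (\<lambda>y. k (norm y) *\<^sub>R y) x = norm x * k' + real CARD('n) * k (norm x)"
proof -
  have "(\<Sum>i\<in>UNIV. x $ i * x $ i) = norm x * norm x"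
    by (metis inner_vec_def inner_real_def power2_norm_eq_inner power2_eq_square)
  then have "(\<Sum>i\<in>UNIV. k' * (x $ i / norm x) * x $ i) = norm x * k'"
    by (simp add: x mult.assoc flip: sum_distrib_left sum_divide_distrib)
  then show ?thesis
    by (simp add: divergence_eqI[OF radial_field_has_derivative[OF x k]] sum.distrib inner_axis)
qed

lemma divergence_radial_field_0:
  assumes "(k \<longlongrightarrow> L) (at_right 0)"
  shows "divergence (\<lambda>y::real^'n. k (norm y) *\<^sub>R y) 0 = real CARD('n) * L"
  by (simp add: divergence_eqI[OF radial_field_has_derivative_0[OF assms]])

text \<open>A flux of strength \<open>\<phi>\<close> in the radial direction has divergence \<open>\<phi>' + (N - 1) \<phi> / r\<close>: it is the field
\<open>k(\<bar>y\<bar>) y\<close> with \<open>k = \<phi> / r\<close>. This turns the \<open>p\<close>-Laplace operator into an ordinary differential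
operator.\<close>

lemma divergence_radial_flux:
  fixes x :: "real^'n"
  assumes x: "x \<noteq> 0" and \<phi>: "(\<phi> has_real_derivative \<phi>') (at (norm x))"
  shows "(\<lambda>y. (\<phi> (norm y) / norm y) *\<^sub>R y) differentiable (at x)"
    and "divergence (\<lambda>y. (\<phi> (norm y) / norm y) *\<^sub>R y) x
      = \<phi>' + (real CARD('n) - 1) * (\<phi> (norm x) / norm x)"
proof -
  have k: "((\<lambda>r. \<phi> r / r) has_real_derivative (\<phi>' - \<phi> (norm x) / norm x) / norm x) (at (norm x))"
    using x by (auto intro!: derivative_eq_intros \<phi> simp: field_simps)
  show "(\<lambda>y. (\<phi> (norm y) / norm y) *\<^sub>R y) differentiable (at x)"
    using radial_field_has_derivative[OF x k] by (rule differentiableI)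
  show "divergence (\<lambda>y. (\<phi> (norm y) / norm y) *\<^sub>R y) x
      = \<phi>' + (real CARD('n) - 1) * (\<phi> (norm x) / norm x)"
    using x by (simp add: divergence_radial_field[OF x k] field_simps)
qed

section \<open>Radial functions with a prescribed slope\<close>

text \<open>The assumptions on \<open>U\<close> and its slope \<open>w\<close> are those that make \<open>U(\<bar>x\<bar>)\<close> continuously
  differentiable on the whole space, the origin included.\<close>

locale radial_slope =
  fixes U w :: "real \<Rightarrow> real"
  assumes U_deriv: "\<And>r. 0 \<le> r \<Longrightarrow> (U has_real_derivative w r) (at r within {0..})"
    and w_cont: "continuous_on {0..} w" and w_0: "w 0 = 0"
begin

lemma grad_radial: "grad (\<lambda>y. U (norm y)) x = (w (norm x) / norm x) *\<^sub>R x"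
proof (cases "x = 0")
  case True
  then show ?thesis
    using grad_eqI[of "\<lambda>y. U (norm y)" 0 0] radial_function_has_derivative_0[of U] U_deriv[of 0]
    by (simp add: w_0)
next
  case False
  then show ?thesis
    using U_deriv[of "norm x"]
    by (intro grad_eqI radial_function_has_derivative) (simp_all add: at_within_atLeast_0)
qed

lemma norm_grad_radial: "norm (grad (\<lambda>y. U (norm y)) x) = \<bar>w (norm x)\<bar>"
  by (cases "x = 0") (simp_all add: grad_radial w_0)

lemma radial_differentiable: "(\<lambda>y. U (norm y)) differentiable (at (x::real^'n))"
proof (cases "x = 0")
  case True
  then show ?thesis
    using differentiableI[OF radial_function_has_derivative_0[of U]] U_deriv[of 0] by (simp add: w_0)
next
  case False
  then show ?thesis
    using radial_function_has_derivative[OF False, of U "w (norm x)"] U_deriv[of "norm x"]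
    by (auto simp: at_within_atLeast_0 differentiableI)
qed

lemma radial_C1: "C1_on UNIV (\<lambda>y::real^'n. U (norm y))"
  unfolding C1_on_def
proof (intro conjI ballI radial_differentiable)
  let ?g = "\<lambda>x::real^'n. (w (norm x) / norm x) *\<^sub>R x"
  have w: "continuous_on UNIV (\<lambda>x::real^'n. w (norm x))"
    by (rule continuous_on_compose2[OF w_cont]) (auto intro: continuous_intros)
  have "isCont ?g x" for x
  proof (cases "x = 0")
    case True
    have "((\<lambda>y::real^'n. \<bar>w (norm y)\<bar>) \<longlongrightarrow> \<bar>w (norm (0::real^'n))\<bar>) (at 0)"
      by (intro tendsto_rabs w[unfolded continuous_on_def, rule_format]) simp
    then have "((\<lambda>y. norm (?g y)) \<longlongrightarrow> 0) (at 0)"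
      unfolding norm_zero w_0 abs_zero
      by (rule Lim_transform_eventually) (auto simp: eventually_at_filter)
    then have "(?g \<longlongrightarrow> 0) (at 0)" by (rule tendsto_norm_zero_cancel)
    then show ?thesis by (simp add: True isCont_def)
  next
    case False
    have "isCont (\<lambda>x::real^'n. w (norm x)) x"
      using w by (simp add: continuous_on_eq_continuous_at)
    then show ?thesis using False by (intro continuous_intros) auto
  qed
  then show "continuous_on UNIV (grad (\<lambda>y::real^'n. U (norm y)))"
    by (subst grad_radial[abs_def]) (simp add: continuous_at_imp_continuous_on)
qed

context
  fixes w' :: "real \<Rightarrow> real"
  assumes w_deriv: "\<And>r. 0 < r \<Longrightarrow> (w has_real_derivative w' r) (at r)"
    and w'_cont: "continuous_on {0<..} w'"
begin

text \<open>The entries of the Hessian, in the form in which they are visibly continuous.\<close>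

lemma grad_grad_radial:
  fixes x :: "real^'n"
  assumes x: "x \<noteq> 0"
  shows "((\<lambda>y. grad (\<lambda>y. U (norm y)) y $ i) has_derivative
      (\<lambda>h. ((w (norm x) / norm x) *\<^sub>R axis i 1
        + ((w' (norm x) - w (norm x) / norm x) * (x $ i / norm x)) *\<^sub>R ((1 / norm x) *\<^sub>R x)) \<bullet> h)) (at x)"
proof -
  have k: "((\<lambda>r. w r / r) has_real_derivative (w' (norm x) - w (norm x) / norm x) / norm x) (at (norm x))"
    using x by (auto intro!: derivative_eq_intros w_deriv simp: field_simps)
  show ?thesis
    unfolding grad_radial
    by (rule has_derivative_eq_rhs[OF bounded_linear.has_derivative[OF bounded_linear_vec_nth
          radial_field_has_derivative[OF x k]]])
      (auto simp: fun_eq_iff inner_axis' inner_add_left)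
qed

lemma radial_C2_away_from_0: "C2_on (- {0}) (\<lambda>y::real^'n. U (norm y))"
  unfolding C2_on_def
proof (intro conjI allI)
  show "C1_on (- {0}) (\<lambda>y::real^'n. U (norm y))"
    using radial_C1 by (auto simp: C1_on_def intro: continuous_on_subset)
  fix i :: 'n
  show "C1_on (- {0}) (\<lambda>x. grad (\<lambda>y. U (norm y)) x $ i)"
    unfolding C1_on_def
  proof (intro conjI ballI)
    fix x :: "real^'n" assume "x \<in> - {0}"
    then show "(\<lambda>x. grad (\<lambda>y. U (norm y)) x $ i) differentiable at x"
      by (auto intro: differentiableI[OF grad_grad_radial])
  next
    have w: "continuous_on (- {0}) (\<lambda>x::real^'n. w (norm x))"
      by (rule continuous_on_compose2[OF w_cont]) (auto intro: continuous_intros)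
    have w': "continuous_on (- {0}) (\<lambda>x::real^'n. w' (norm x))"
      by (rule continuous_on_compose2[OF w'_cont]) (auto intro: continuous_intros)
    have "continuous_on (- {0}) (\<lambda>x::real^'n. (w (norm x) / norm x) *\<^sub>R axis i 1
        + ((w' (norm x) - w (norm x) / norm x) * (x $ i / norm x)) *\<^sub>R ((1 / norm x) *\<^sub>R x))"
      by (intro continuous_intros w w') auto
    then show "continuous_on (- {0}) (grad (\<lambda>x::real^'n. grad (\<lambda>y. U (norm y)) x $ i))"
      by (rule continuous_on_eq) (auto simp: grad_eqI[OF grad_grad_radial])
  qed
qed

text \<open>With \<open>k = w / r\<close> the gradient is \<open>k(\<bar>x\<bar>) x\<close>, and its derivative is \<open>k\<close> times the identity plus a
rank-one part with factor \<open>w' - w / r\<close>. The Hessian is thus continuous at the origin, with value \<open>l\<close>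
times the identity, as soon as \<open>w / r\<close> and \<open>w'\<close> have the common limit \<open>l\<close>.\<close>

lemma radial_C2:
  assumes l: "((\<lambda>r. w r / r) \<longlongrightarrow> l) (at_right 0)" and l': "(w' \<longlongrightarrow> l) (at_right 0)"
  shows "C2_on UNIV (\<lambda>y::real^'n. U (norm y))"
  unfolding C2_on_def
proof (intro conjI allI radial_C1)
  fix i :: 'n
  let ?G = "\<lambda>x::real^'n. grad (\<lambda>y. U (norm y)) x $ i"
  note away = radial_C2_away_from_0[unfolded C2_on_def C1_on_def, THEN conjunct2, rule_format, of i]
  have "(?G has_derivative (\<lambda>h. (l *\<^sub>R h) $ i)) (at 0)"
    unfolding grad_radial
    by (rule bounded_linear.has_derivative[OF bounded_linear_vec_nth radial_field_has_derivative_0[OF l]])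
  then have G_0: "(?G has_derivative (\<lambda>h. (l *\<^sub>R axis i 1) \<bullet> h)) (at 0)"
    by (rule has_derivative_eq_rhs) (auto simp: inner_axis')
  show "C1_on UNIV ?G"
    unfolding C1_on_def
  proof (intro conjI ballI)
    fix x :: "real^'n"
    show "?G differentiable at x"
      using away G_0 by (cases "x = 0") (auto intro: differentiableI)
  next
    have "isCont (grad ?G) x" for x
    proof (cases "x = 0")
      case True
      let ?H = "\<lambda>x::real^'n. (w (norm x) / norm x) *\<^sub>R axis i 1
        + ((w' (norm x) - w (norm x) / norm x) * (x $ i / norm x)) *\<^sub>R ((1 / norm x) *\<^sub>R x)"
      note lim = filterlim_compose[OF _ norm_tendsto_at_right_0]
      \<comment> \<open>The rank-one part of the Hessian has bounded direction and a factor that tends to zero.\<close>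
      have "((\<lambda>r. w' r - w r / r) \<longlongrightarrow> 0) (at_right 0)"
        using tendsto_diff[OF l' l] by simp
      from tendsto_rabs_zero[OF lim[OF this]]
      have "((\<lambda>x::real^'n. ((w' (norm x) - w (norm x) / norm x) * (x $ i / norm x)) *\<^sub>R ((1 / norm x) *\<^sub>R x))
          \<longlongrightarrow> 0) (at 0)"
      proof (rule Lim_null_comparison[rotated])
        have "norm (((w' (norm x) - w (norm x) / norm x) * (x $ i / norm x)) *\<^sub>R ((1 / norm x) *\<^sub>R x))
            \<le> \<bar>w' (norm x) - w (norm x) / norm x\<bar>" if "x \<noteq> 0" for x :: "real^'n"
          using component_le_norm_cart[of x i] that
            mult_left_le[of "\<bar>x $ i\<bar> / norm x" "\<bar>w' (norm x) - w (norm x) / norm x\<bar>"]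
          by (simp add: abs_mult)
        then show "\<forall>\<^sub>F x::real^'n in at 0. norm (((w' (norm x) - w (norm x) / norm x) * (x $ i / norm x)) *\<^sub>R
            ((1 / norm x) *\<^sub>R x)) \<le> \<bar>w' (norm x) - w (norm x) / norm x\<bar>"
          by (auto simp: eventually_at_filter)
      qed
      from tendsto_add[OF tendsto_scaleR[OF lim[OF l] tendsto_const[of "axis i 1"]] this]
      have "(?H \<longlongrightarrow> l *\<^sub>R axis i 1) (at 0)" by simp
      then have "(grad ?G \<longlongrightarrow> l *\<^sub>R axis i 1) (at 0)"
        by (rule Lim_transform_eventually)
          (auto simp: eventually_at_filter grad_eqI[OF grad_grad_radial])
      then show ?thesis by (simp add: True isCont_def grad_eqI[OF G_0])
    next
      case False
      then show ?thesis
        using away continuous_on_eq_continuous_at[of "- {0}" "grad ?G"] by auto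
    qed
    then show "continuous_on UNIV (grad ?G)"
      by (simp add: continuous_at_imp_continuous_on)
  qed
qed

end

lemma p_flux_radial:
  "p_flux p (\<lambda>y. U (norm y)) = (\<lambda>x. (\<bar>w (norm x)\<bar> powr (p - 2) * w (norm x) / norm x) *\<^sub>R x)"
  by (auto simp: fun_eq_iff p_flux_def norm_grad_radial grad_radial)

end

section \<open>The integral operator\<close>

text \<open>The number \<open>\<nu>\<close> stands for \<open>N - 1\<close>, the exponent of the radial volume weight.\<close>

locale system_exponents =
  fixes p m q \<alpha> \<beta> \<nu> :: real
  assumes p: "1 < p" and m: "0 < m" and q: "0 < q" and \<alpha>_nonneg: "0 \<le> \<alpha>" and \<alpha>_less: "\<alpha> < p - 1"
    and \<beta>: "0 \<le> \<beta>" and \<nu>: "0 < \<nu>" and \<delta>: "q * m < (p - 1 - \<alpha>) * (p - 1 - \<beta>)"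
begin

text \<open>Raising the flux \<open>r\<^sup>\<nu> w\<^sup>p\<^sup>-\<^sup>1\<close> of \<open>u\<close> to the power \<open>\<theta>\<close> removes the factor \<open>w\<^sup>\<alpha>\<close> from its equation and
changes the weight \<open>r\<^sup>\<nu>\<close> into \<open>r\<^sup>\<kappa>\<close>; \<open>g\<close> is the exponent that then recovers \<open>w\<close>. The number \<open>\<sigma>\<close> is
the degree of homogeneity of \<open>V \<mapsto> slope_v V\<close> below.\<close>

definition "\<theta> = (p - 1 - \<alpha>) / (p - 1)"
definition "\<kappa> = \<nu> * \<theta>"
definition "g = 1 / (p - 1 - \<alpha>)"
definition "\<sigma> = (\<beta> + m * g * q) / (p - 1)"

definition source_u :: "(real \<Rightarrow> real) \<Rightarrow> real \<Rightarrow> real" where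
  "source_u V r = \<theta> * V r powr m"

definition slope_u :: "(real \<Rightarrow> real) \<Rightarrow> real \<Rightarrow> real" where
  "slope_u V r = wmean \<kappa> (source_u V) r powr g"

definition source_v :: "(real \<Rightarrow> real) \<Rightarrow> real \<Rightarrow> real" where
  "source_v V r = V r powr \<beta> * slope_u V r powr q"

definition slope_v :: "(real \<Rightarrow> real) \<Rightarrow> real \<Rightarrow> real" where
  "slope_v V r = wmean \<nu> (source_v V) r powr (1 / (p - 1))"

definition integral_op :: "real \<Rightarrow> (real \<Rightarrow> real) \<Rightarrow> real \<Rightarrow> real" where
  "integral_op b V r = b + integral {0..r} (slope_v V)"

definition admissible :: "(real \<Rightarrow> real) \<Rightarrow> bool" where
  "admissible V \<longleftrightarrow> continuous_on {0..} V \<and> (\<forall>r\<ge>0. 0 < V r)"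

lemma \<theta>_pos: "0 < \<theta>" and \<kappa>_pos: "0 < \<kappa>" and g_pos: "0 < g"
  using p \<alpha>_less \<nu> by (auto simp: \<theta>_def \<kappa>_def g_def)

lemma \<sigma>_nonneg: "0 \<le> \<sigma>"
  using p m q \<beta> g_pos by (simp add: \<sigma>_def)

text \<open>This is the only place where the sign of \<open>\<delta>\<close> enters: \<open>\<delta> > 0\<close> says precisely that the slope of \<open>v\<close>
depends on \<open>v\<close> with a degree of homogeneity below one.\<close>

lemma \<sigma>_less_1: "\<sigma> < 1"
proof -
  have "m * g * q < p - 1 - \<beta>"
    using \<delta> \<alpha>_less by (simp add: g_def field_simps)
  then show ?thesis using p by (simp add: \<sigma>_def)
qed

context
  fixes V assumes V: "admissible V"
begin

lemma source_u_cont: "continuous_on {0..} (source_u V)"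
  unfolding source_u_def using V
  by (intro continuous_intros) (auto simp: admissible_def less_imp_neq[symmetric] intro: less_imp_le)

lemma source_u_pos: "0 \<le> r \<Longrightarrow> 0 < source_u V r"
  using V \<theta>_pos by (auto simp: source_u_def admissible_def less_imp_neq[symmetric])

lemma slope_u_cont: "continuous_on {0..} (slope_u V)"
  unfolding slope_u_def using g_pos
  by (intro continuous_on_powr' continuous_on_wmean \<kappa>_pos source_u_cont continuous_on_const ballI conjI
      wmean_nonneg) (auto intro: less_imp_le source_u_pos)

lemma slope_u_nonneg: "0 \<le> slope_u V r"
  by (simp add: slope_u_def)

lemma slope_u_0: "slope_u V 0 = 0"
  by (simp add: slope_u_def)

lemma slope_u_pos: "0 < r \<Longrightarrow> 0 < slope_u V r"
  using wmean_pos[OF \<kappa>_pos source_u_cont source_u_pos, of r] by (simp add: slope_u_def)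

lemma source_v_cont: "continuous_on {0..} (source_v V)"
proof -
  have "continuous_on {0..} (\<lambda>r. V r powr \<beta>)"
    using V by (intro continuous_on_powr) (auto simp: admissible_def less_imp_neq[symmetric])
  moreover have "continuous_on {0..} (\<lambda>r. slope_u V r powr q)"
    using q by (intro continuous_on_powr' slope_u_cont) (auto simp: slope_u_nonneg)
  ultimately show ?thesis unfolding source_v_def by (rule continuous_on_mult)
qed

lemma source_v_pos: "0 < r \<Longrightarrow> 0 < source_v V r"
  using V slope_u_pos[of r] by (auto simp: source_v_def admissible_def less_imp_neq[symmetric])

lemma source_v_nonneg: "0 \<le> source_v V r"
  by (simp add: source_v_def)

lemma slope_v_cont: "continuous_on {0..} (slope_v V)"
  unfolding slope_v_def using p
  by (intro continuous_on_powr' continuous_on_wmean \<nu> source_v_cont continuous_on_const ballI conjI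
      wmean_nonneg) (auto intro: source_v_nonneg)

lemma slope_v_nonneg: "0 \<le> slope_v V r"
  by (simp add: slope_v_def)

lemma slope_v_0: "slope_v V 0 = 0"
  by (simp add: slope_v_def)

lemma slope_v_pos: "0 < r \<Longrightarrow> 0 < slope_v V r"
  using wmean_pos[OF \<nu> source_v_cont source_v_pos, of r] by (simp add: slope_v_def)

lemma slope_v_integrable: "slope_v V integrable_on {0..r}"
  by (rule integrable_continuous_real) (auto intro: continuous_on_subset[OF slope_v_cont])

lemma integral_op_cont: "continuous_on {0..} (integral_op b V)"
  unfolding integral_op_def
  by (intro continuous_intros continuous_on_integral_from_0 slope_v_cont)

lemma integral_op_ge: "b \<le> integral_op b V r"
  by (simp add: integral_op_def integral_nonneg slope_v_integrable slope_v_nonneg)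

lemma integral_op_deriv:
  "0 \<le> r \<Longrightarrow> (integral_op b V has_real_derivative slope_v V r) (at r within {0..})"
  unfolding integral_op_def
  by (rule derivative_eq_intros has_real_derivative_integral_from_0[OF slope_v_cont] refl | simp)+

end

text \<open>Every ingredient of \<open>slope_v\<close> is monotone and positively homogeneous: \<open>slope_u\<close> has degree \<open>m g\<close>,
\<open>source_v\<close> has degree \<open>\<beta> + m g q\<close> and \<open>slope_v\<close> has degree \<open>\<sigma>\<close>. Values at \<open>r\<close> depend on \<open>V\<close> only up
to \<open>r\<close>, so an inequality on \<open>[0, R]\<close> suffices.\<close>

lemma slope_v_le:
  assumes V: "admissible V" and W: "admissible W" and c: "0 < c"
    and le: "\<And>r. 0 \<le> r \<Longrightarrow> r \<le> R \<Longrightarrow> V r \<le> c * W r" and r: "0 \<le> r" "r \<le> R"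
  shows "slope_v V r \<le> c powr \<sigma> * slope_v W r"
proof -
  have u: "slope_u V s \<le> c powr (m * g) * slope_u W s" if "0 \<le> s" "s \<le> R" for s
  proof -
    have "wmean \<kappa> (source_u V) s \<le> wmean \<kappa> (\<lambda>t. c powr m * source_u W t) s"
    proof (rule wmean_mono[OF \<kappa>_pos source_u_cont[OF V]])
      show "continuous_on {0..} (\<lambda>t. c powr m * source_u W t)"
        by (intro continuous_intros source_u_cont W)
      fix t assume t: "0 \<le> t" "t \<le> s"
      have "V t powr m \<le> (c * W t) powr m"
        using le[of t] t that V m by (intro powr_mono2) (auto simp: admissible_def less_imp_le)
      then show "source_u V t \<le> c powr m * source_u W t"
        using \<theta>_pos t c W by (simp add: source_u_def admissible_def powr_mult less_imp_le)
    qed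
    then have "wmean \<kappa> (source_u V) s \<le> c powr m * wmean \<kappa> (source_u W) s"
      by (simp add: wmean_cmult[OF \<kappa>_pos])
    then have "slope_u V s \<le> (c powr m * wmean \<kappa> (source_u W) s) powr g"
      unfolding slope_u_def
      by (intro powr_mono2 wmean_nonneg[OF \<kappa>_pos source_u_cont[OF V]])
        (auto intro: less_imp_le source_u_pos[OF V] g_pos)
    also have "\<dots> = c powr (m * g) * slope_u W s"
      using wmean_nonneg[OF \<kappa>_pos source_u_cont[OF W] less_imp_le[OF source_u_pos[OF W]], of s]
      by (simp add: slope_u_def powr_mult powr_powr)
    finally show ?thesis .
  qed
  have "wmean \<nu> (source_v V) r \<le> wmean \<nu> (\<lambda>t. c powr (\<beta> + m * g * q) * source_v W t) r"
  proof (rule wmean_mono[OF \<nu> source_v_cont[OF V]])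
    show "continuous_on {0..} (\<lambda>t. c powr (\<beta> + m * g * q) * source_v W t)"
      by (intro continuous_intros source_v_cont W)
    fix t assume t: "0 \<le> t" "t \<le> r"
    have "V t powr \<beta> \<le> (c * W t) powr \<beta>"
      using le[of t] t r V \<beta> by (intro powr_mono2) (auto simp: admissible_def less_imp_le)
    moreover have "slope_u V t powr q \<le> (c powr (m * g) * slope_u W t) powr q"
      using u[of t] t r q by (intro powr_mono2) (auto simp: slope_u_nonneg[OF V])
    ultimately have "source_v V t \<le> (c * W t) powr \<beta> * (c powr (m * g) * slope_u W t) powr q"
      unfolding source_v_def by (intro mult_mono) auto
    then show "source_v V t \<le> c powr (\<beta> + m * g * q) * source_v W t"
      using c t W by (simp add: source_v_def admissible_def powr_mult powr_powr powr_add
          slope_u_nonneg[OF W] less_imp_le mult_ac)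
  qed
  then have "wmean \<nu> (source_v V) r \<le> c powr (\<beta> + m * g * q) * wmean \<nu> (source_v W) r"
    by (simp add: wmean_cmult[OF \<nu>])
  then have "slope_v V r \<le> (c powr (\<beta> + m * g * q) * wmean \<nu> (source_v W) r) powr (1 / (p - 1))"
    unfolding slope_v_def using p
    by (intro powr_mono2 wmean_nonneg[OF \<nu> source_v_cont[OF V]]) (auto intro: source_v_nonneg[OF V])
  also have "\<dots> = c powr \<sigma> * slope_v W r"
    using wmean_nonneg[OF \<nu> source_v_cont[OF W] source_v_nonneg[OF W], of r]
    by (simp add: slope_v_def powr_mult powr_powr \<sigma>_def)
  finally show ?thesis .
qed

lemma integral_op_le:
  assumes V: "admissible V" and W: "admissible W" and b: "0 < b" and c: "1 \<le> c"
    and le: "\<And>r. 0 \<le> r \<Longrightarrow> r \<le> R \<Longrightarrow> V r \<le> c * W r" and r: "0 \<le> r" "r \<le> R"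
  shows "integral_op b V r \<le> c powr \<sigma> * integral_op b W r"
proof -
  have "integral {0..r} (slope_v V) \<le> integral {0..r} (\<lambda>t. c powr \<sigma> * slope_v W t)"
  proof (rule integral_le)
    show "slope_v V integrable_on {0..r}" by (rule slope_v_integrable[OF V])
    show "(\<lambda>t. c powr \<sigma> * slope_v W t) integrable_on {0..r}"
      by (intro integrable_on_mult_right slope_v_integrable[OF W])
    fix t assume "t \<in> {0..r}"
    then show "slope_v V t \<le> c powr \<sigma> * slope_v W t"
      using slope_v_le[OF V W _ le, of t] c r by auto
  qed
  moreover have "b \<le> c powr \<sigma> * b"
    using b ge_one_powr_ge_zero[OF c \<sigma>_nonneg] by simp
  ultimately show ?thesis by (simp add: integral_op_def distrib_left)
qed

text \<open>An order-preserving map with degree of homogeneity \<open>\<sigma>\<close> contracts the distance between logarithms by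
the factor \<open>\<sigma>\<close> (Thompson's metric on the cone of positive functions); the additive constant \<open>b\<close> does
no harm because \<open>b \<le> c\<^sup>\<sigma> b\<close> for \<open>c \<ge> 1\<close>.\<close>

lemma integral_op_contraction:
  assumes V: "admissible V" and W: "admissible W" and b: "0 < b"
    and D: "\<And>r. 0 \<le> r \<Longrightarrow> r \<le> R \<Longrightarrow> \<bar>ln (V r) - ln (W r)\<bar> \<le> D" and r: "0 \<le> r" "r \<le> R"
  shows "\<bar>ln (integral_op b V r) - ln (integral_op b W r)\<bar> \<le> \<sigma> * D"
proof -
  have "0 \<le> D" using D[OF r] by linarith
  have *: "ln (integral_op b V r) - ln (integral_op b W r) \<le> \<sigma> * D"
    if V: "admissible V" and W: "admissible W"
      and D: "\<And>r. 0 \<le> r \<Longrightarrow> r \<le> R \<Longrightarrow> ln (V r) - ln (W r) \<le> D" for V W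
  proof -
    have "V t \<le> exp D * W t" if "0 \<le> t" "t \<le> R" for t
    proof -
      have "0 < V t" "0 < W t" using V W that by (auto simp: admissible_def)
      moreover have "exp (ln (V t)) \<le> exp (D + ln (W t))" using D[OF that] by simp
      ultimately show ?thesis by (simp add: exp_add)
    qed
    from integral_op_le[OF V W b _ this r]
    have "integral_op b V r \<le> exp D powr \<sigma> * integral_op b W r"
      using \<open>0 \<le> D\<close> by simp
    moreover have "0 < integral_op b V r" "0 < integral_op b W r"
      using integral_op_ge[OF V, of b r] integral_op_ge[OF W, of b r] b by linarith+
    ultimately have "ln (integral_op b V r) \<le> ln (exp D powr \<sigma> * integral_op b W r)"
      by simp
    also have "\<dots> = \<sigma> * D + ln (integral_op b W r)"
      using \<open>0 < integral_op b W r\<close> by (simp add: ln_mult ln_powr)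
    finally show ?thesis by simp
  qed
  have D': "ln (V r) - ln (W r) \<le> D" "ln (W r) - ln (V r) \<le> D" if "0 \<le> r" "r \<le> R" for r
    using D[OF that] by linarith+
  show ?thesis
    using *[OF V W D'(1)] *[OF W V D'(2)] by linarith
qed

section \<open>The fixed point\<close>

text \<open>The largest distance between the logarithms of two fixed points on \<open>[0, R]\<close> is attained and is at
most \<open>\<sigma>\<close> times itself.\<close>

lemma fixed_point_unique:
  assumes V: "admissible V" and W: "admissible W" and b: "0 < b"
    and fV: "\<And>r. 0 \<le> r \<Longrightarrow> r \<le> R \<Longrightarrow> V r = integral_op b V r"
    and fW: "\<And>r. 0 \<le> r \<Longrightarrow> r \<le> R \<Longrightarrow> W r = integral_op b W r" and r: "0 \<le> r" "r \<le> R"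
  shows "V r = W r"
proof -
  let ?d = "\<lambda>r. \<bar>ln (V r) - ln (W r)\<bar>"
  have "continuous_on {0..R} ?d"
    using V W by (intro continuous_intros)
      (auto simp: admissible_def less_imp_neq[symmetric] intro: continuous_on_subset)
  then obtain s where s: "s \<in> {0..R}" "\<And>t. t \<in> {0..R} \<Longrightarrow> ?d t \<le> ?d s"
    using continuous_attains_sup[of "{0..R}" ?d] r by auto
  have "?d s \<le> \<sigma> * ?d s"
    using integral_op_contraction[OF V W b, of R "?d s" s] s fV[of s] fW[of s] by auto
  then have "(1 - \<sigma>) * ?d s \<le> 0" by (simp add: algebra_simps)
  then have "?d s \<le> 0" using \<sigma>_less_1 by (simp add: mult_le_0_iff)
  then have "?d r = 0" using s(2)[of r] r by simp
  then show ?thesis using V W r by (simp add: admissible_def)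
qed

text \<open>Banach's theorem for \<open>f \<mapsto> ln (integral_op b (exp f))\<close> on bounded continuous functions. The argument
is truncated to \<open>[0, R]\<close> so that the image is bounded on the whole real line.\<close>

lemma fixed_point_local:
  assumes b: "0 < b" and R: "0 \<le> R"
  shows "\<exists>V. admissible V \<and> (\<forall>r. 0 \<le> r \<longrightarrow> r \<le> R \<longrightarrow> V r = integral_op b V r)"
proof -
  define cut where "cut r = max 0 (min R r)" for r :: real
  have cut: "0 \<le> cut r" "cut r \<le> R" for r using R by (auto simp: cut_def)
  have cut_cont: "continuous_on UNIV cut" unfolding cut_def by (intro continuous_intros)
  define G where "G f r = ln (integral_op b (\<lambda>s. exp (apply_bcontfun f s)) (cut r))"
    for f :: "real \<Rightarrow>\<^sub>C real" and r
  have adm: "admissible (\<lambda>s. exp (apply_bcontfun f s))" for f :: "real \<Rightarrow>\<^sub>C real"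
    by (auto simp: admissible_def intro!: continuous_intros)
  have op_pos: "0 < integral_op b (\<lambda>s. exp (apply_bcontfun f s)) r" for f :: "real \<Rightarrow>\<^sub>C real" and r
    using integral_op_ge[OF adm, of b f r] b by linarith
  have "G f \<in> bcontfun" for f
  proof -
    have L: "continuous_on {0..} (\<lambda>r. ln (integral_op b (\<lambda>s. exp (apply_bcontfun f s)) r))"
      using op_pos[of f] by (intro continuous_on_ln integral_op_cont[OF adm]) (auto simp: less_imp_neq[symmetric])
    have "continuous_on UNIV (G f)"
      unfolding G_def by (rule continuous_on_compose2[OF L cut_cont]) (use cut in auto)
    moreover have "bounded (range (G f))"
    proof (rule bounded_subset)
      have "compact ((\<lambda>r. ln (integral_op b (\<lambda>s. exp (apply_bcontfun f s)) r)) ` {0..R})"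
        by (rule compact_continuous_image[OF continuous_on_subset[OF L]]) auto
      then show "bounded ((\<lambda>r. ln (integral_op b (\<lambda>s. exp (apply_bcontfun f s)) r)) ` {0..R})"
        by (rule compact_imp_bounded)
      show "range (G f) \<subseteq> (\<lambda>r. ln (integral_op b (\<lambda>s. exp (apply_bcontfun f s)) r)) ` {0..R}"
        using cut by (auto simp: G_def)
    qed
    ultimately show ?thesis by (simp add: bcontfun_def)
  qed
  then have G: "apply_bcontfun (Bcontfun (G f)) = G f" for f
    by (simp add: Bcontfun_inverse)
  have "\<exists>!f. Bcontfun (G f) = f"
  proof (rule banach_fix_type[OF \<sigma>_nonneg \<sigma>_less_1], intro allI)
    fix f h :: "real \<Rightarrow>\<^sub>C real"
    show "dist (Bcontfun (G f)) (Bcontfun (G h)) \<le> \<sigma> * dist f h"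
    proof (rule dist_bound)
      fix r
      have "\<bar>apply_bcontfun f s - apply_bcontfun h s\<bar> \<le> dist f h" for s
        using dist_bounded[of f s h] by (simp add: dist_real_def)
      then show "dist (apply_bcontfun (Bcontfun (G f)) r) (apply_bcontfun (Bcontfun (G h)) r) \<le> \<sigma> * dist f h"
        unfolding G dist_real_def G_def
        by (intro integral_op_contraction[OF adm adm b, of R]) (auto simp: cut)
    qed
  qed
  then obtain f where f: "Bcontfun (G f) = f" by auto
  have "exp (apply_bcontfun f r) = integral_op b (\<lambda>s. exp (apply_bcontfun f s)) r"
    if "0 \<le> r" "r \<le> R" for r
  proof -
    have "apply_bcontfun f r = G f r" using G[of f] f by simp
    moreover have "cut r = r" using that by (simp add: cut_def)
    ultimately show ?thesis using op_pos[of f r] by (simp add: G_def)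
  qed
  with adm show ?thesis by blast
qed

lemma integral_op_cong:
  assumes V: "admissible V" and W: "admissible W"
    and eq: "\<And>r. 0 \<le> r \<Longrightarrow> r \<le> R \<Longrightarrow> V r = W r" and r: "r \<le> R"
  shows "integral_op b V r = integral_op b W r"
proof -
  have "slope_v V t = slope_v W t" if "t \<in> {0..r}" for t
    using slope_v_le[OF V W, of 1 R t] slope_v_le[OF W V, of 1 R t] eq that r by auto
  then have "integral {0..r} (slope_v V) = integral {0..r} (slope_v W)"
    by (rule Henstock_Kurzweil_Integration.integral_cong)
  then show ?thesis by (simp add: integral_op_def)
qed

text \<open>The factor \<open>\<sigma>\<close> does not depend on the interval, so there is a fixed point on each \<open>[0, R]\<close>, and by
uniqueness these agree where they overlap: no continuation argument is needed.\<close>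

theorem fixed_point_global:
  assumes b: "0 < b"
  shows "\<exists>V. admissible V \<and> (\<forall>r\<ge>0. V r = integral_op b V r)"
proof -
  have "\<forall>R\<in>{0..}. \<exists>V. admissible V \<and> (\<forall>r. 0 \<le> r \<longrightarrow> r \<le> R \<longrightarrow> V r = integral_op b V r)"
    using fixed_point_local[OF b] by auto
  then obtain X where "\<forall>R\<in>{0..}. admissible (X R) \<and>
      (\<forall>r. 0 \<le> r \<longrightarrow> r \<le> R \<longrightarrow> X R r = integral_op b (X R) r)"
    unfolding bchoice_iff by blast
  then have X: "\<And>R. 0 \<le> R \<Longrightarrow> admissible (X R)"
      "\<And>R r. 0 \<le> R \<Longrightarrow> 0 \<le> r \<Longrightarrow> r \<le> R \<Longrightarrow> X R r = integral_op b (X R) r"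
    by simp_all
  define V where "V r = X r r" for r
  have V: "V r = X R r" if "0 \<le> r" "r \<le> R" for r R
    unfolding V_def using that by (intro fixed_point_unique[OF X(1) X(1) b, of r R r]) (auto intro: X)
  have adm: "admissible V"
    unfolding admissible_def
  proof
    show "\<forall>r\<ge>0. 0 < V r" using X(1) by (auto simp: V_def admissible_def)
    have "continuous (at r within {0..}) V" if r: "0 \<le> r" for r
    proof -
      have "continuous_on {0..r+1} (X (r+1))"
        using X(1)[of "r+1"] r by (auto simp: admissible_def intro: continuous_on_subset)
      then have "continuous_on {0..r+1} V"
        by (rule continuous_on_eq) (auto intro: V[symmetric])
      moreover have "at r within {0..} = at r within {0..r+1}"
        by (rule at_within_nhd[where S="{..<r+1}"]) auto
      ultimately show ?thesis using r by (simp add: continuous_on_eq_continuous_within)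
    qed
    then show "continuous_on {0..} V" by (simp add: continuous_on_eq_continuous_within)
  qed
  moreover have "V r = integral_op b V r" if "0 \<le> r" for r
    using X(2)[of r r] integral_op_cong[OF adm X(1), of r r r] V that by (simp add: V_def)
  ultimately show ?thesis by blast
qed

end

section \<open>From solutions to the fixed point\<close>

text \<open>The slope itself may fail to be differentiable where it vanishes. What is differentiable is the flux,
and its radial component is read off by restricting the flux to the ray through \<open>x\<close>.\<close>

lemma (in radial_slope) p_flux_radial_ode:
  fixes x :: "real^'n"
  defines "N1 \<equiv> real CARD('n) - 1"
  assumes x: "x \<noteq> 0" and diff: "p_flux p (\<lambda>y::real^'n. U (norm y)) differentiable (at x)"
  shows "((\<lambda>r. r powr N1 * (\<bar>w r\<bar> powr (p - 2) * w r)) has_real_derivative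
    norm x powr N1 * p_laplace p (\<lambda>y. U (norm y)) x) (at (norm x))"
proof -
  let ?\<phi> = "\<lambda>r. \<bar>w r\<bar> powr (p - 2) * w r"
  let ?F = "p_flux p (\<lambda>y::real^'n. U (norm y))"
  obtain F' where F': "(?F has_derivative F') (at x)"
    using diff by (auto simp: differentiable_def)
  have x_eq: "norm x *\<^sub>R sgn x = x" using x by (simp add: sgn_div_norm)
  have "((\<lambda>r. ?F (r *\<^sub>R sgn x) \<bullet> sgn x) has_derivative (\<lambda>t. F' (t *\<^sub>R sgn x) \<bullet> sgn x)) (at (norm x))"
    by (rule has_derivative_inner_left, rule has_derivative_compose[where g="?F"])
      (auto intro!: derivative_eq_intros simp: x_eq F')
  moreover have "F' (t *\<^sub>R sgn x) \<bullet> sgn x = (F' (sgn x) \<bullet> sgn x) * t" for t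
    using linear_cmul[OF has_derivative_linear[OF F']] by simp
  ultimately have "((\<lambda>r. ?F (r *\<^sub>R sgn x) \<bullet> sgn x) has_real_derivative F' (sgn x) \<bullet> sgn x) (at (norm x))"
    by (simp add: has_field_derivative_def)
  moreover have "?F (r *\<^sub>R sgn x) \<bullet> sgn x = ?\<phi> r" if "0 < r" for r
  proof -
    have "sgn x \<bullet> sgn x = 1" "norm (r *\<^sub>R sgn x) = r"
      using x that by (simp_all add: norm_sgn flip: norm_eq_1)
    then show ?thesis using that by (simp add: p_flux_radial)
  qed
  ultimately obtain \<phi>' where \<phi>': "(?\<phi> has_real_derivative \<phi>') (at (norm x))"
    using x by (metis (no_types, lifting) has_field_derivative_transform_within_open[where S="{0<..}"]
        greaterThan_iff open_greaterThan zero_less_norm_iff)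
  have "p_laplace p (\<lambda>y. U (norm y)) x = \<phi>' + N1 * (?\<phi> (norm x) / norm x)"
    unfolding p_laplace_def p_flux_radial N1_def by (rule divergence_radial_flux(2)[OF x \<phi>'])
  moreover have "((\<lambda>r. r powr N1 * ?\<phi> r) has_real_derivative
      norm x powr N1 * (\<phi>' + N1 * (?\<phi> (norm x) / norm x))) (at (norm x))"
    by (rule derivative_eq_intros \<phi>' refl | use x in \<open>force simp: powr_diff field_simps\<close>)+
  ultimately show ?thesis by simp
qed

lemma radial_slope_of_C1:
  fixes u :: "real^'n \<Rightarrow> real"
  assumes C1: "C1_on UNIV u" and rad: "radially_symmetric u"
  obtains U w where "radial_slope U w" "u = (\<lambda>x. U (norm x))"
proof -
  define e :: "real^'n" where "e = axis undefined 1"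
  have e: "norm e = 1" by (simp add: e_def)
  define U where "U r = u (r *\<^sub>R e)" for r
  define w where "w r = grad u (r *\<^sub>R e) \<bullet> e" for r
  have U_deriv: "(U has_real_derivative w r) (at r)" for r
  proof -
    have "(u has_derivative (\<lambda>h. grad u (r *\<^sub>R e) \<bullet> h)) (at (r *\<^sub>R e))"
      using C1 by (intro has_derivative_grad) (simp add: C1_on_def)
    then have "(U has_derivative (\<lambda>t. grad u (r *\<^sub>R e) \<bullet> (t *\<^sub>R e))) (at r)"
      unfolding U_def by (rule has_derivative_compose[rotated]) (auto intro!: derivative_eq_intros)
    then show ?thesis by (simp add: has_field_derivative_def w_def mult.commute[of _ "_ \<bullet> _"])
  qed
  have u: "u x = U (norm x)" for x
    unfolding U_def by (rule rad[unfolded radially_symmetric_def, rule_format]) (simp add: e)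
  \<comment> \<open>Along a line through the origin a radial function is even.\<close>
  have "((\<lambda>r. U (- r)) has_real_derivative - w 0) (at 0)"
    using DERIV_mirror[where f=U and x=0 and y="w 0"] U_deriv[of 0] by simp
  moreover have "U (- r) = U r" for r
    unfolding U_def by (rule rad[unfolded radially_symmetric_def, rule_format]) simp
  ultimately have "(U has_real_derivative - w 0) (at 0)" by simp
  from DERIV_unique[OF U_deriv[of 0] this] have "w 0 = 0" by simp
  moreover have "continuous_on {0..} w"
  proof -
    have "continuous_on {0..} (\<lambda>r. grad u (r *\<^sub>R e))"
      by (rule continuous_on_compose2[of UNIV "grad u"])
        (use C1 in \<open>auto simp: C1_on_def intro!: continuous_intros\<close>)
    then show ?thesis unfolding w_def by (intro continuous_intros)
  qed
  ultimately have "radial_slope U w"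
    by unfold_locales (auto intro: has_field_derivative_at_within U_deriv)
  then show ?thesis using that u by blast
qed

lemma radial_slope_not_vanishing:
  assumes "radial_slope U w" and nc: "nonconstant_near_0 (\<lambda>x::real^'n. U (norm x))" and \<epsilon>: "0 < \<epsilon>"
  shows "\<exists>r. 0 < r \<and> r < \<epsilon> \<and> w r \<noteq> 0"
proof (rule ccontr)
  interpret radial_slope U w by fact
  assume *: "\<not> ?thesis"
  have cont: "continuous_on {0..} U"
    by (rule DERIV_continuous_on[OF U_deriv]) simp
  have "U r = U 0" if "0 \<le> r" "r < \<epsilon>" for r
  proof (cases "r = 0")
    case False
    then have "0 < r" using that by simp
    then show ?thesis
    proof (rule DERIV_isconst_end)
      show "continuous_on {0..r} U" by (rule continuous_on_subset[OF cont]) auto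
      fix t assume "0 < t" "t < r"
      then show "(U has_real_derivative 0) (at t)"
        using U_deriv[of t] * that by (auto simp: at_within_atLeast_0)
    qed
  qed simp
  then have "(\<lambda>x::real^'n. U (norm x)) constant_on ball 0 \<epsilon>"
    unfolding constant_on_def by (intro exI[of _ "U 0"]) auto
  then show False
    using nc \<epsilon> unfolding nonconstant_near_0_def by (meson centre_in_ball open_ball)
qed

text \<open>Both equations have a nonnegative right-hand side, so the flux through spheres increases from its
value zero at the origin. Hence the slopes are nonnegative, and a flux that is positive once stays
positive.\<close>

lemma flux_monotone:
  fixes w :: "real \<Rightarrow> real"
  assumes p: "1 < p" and \<nu>: "0 < \<nu>" and w: "continuous_on {0..} w" "w 0 = 0"
  defines "\<Phi> \<equiv> \<lambda>r. r powr \<nu> * (\<bar>w r\<bar> powr (p - 2) * w r)"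
  assumes deriv: "\<And>r. 0 < r \<Longrightarrow> (\<Phi> has_real_derivative d r) (at r)" and d: "\<And>r. 0 < r \<Longrightarrow> 0 \<le> d r"
  shows "continuous_on {0..} \<Phi>" and "\<And>r s. 0 \<le> r \<Longrightarrow> r \<le> s \<Longrightarrow> \<Phi> r \<le> \<Phi> s"
    and "\<And>r. 0 \<le> r \<Longrightarrow> 0 \<le> \<Phi> r" and "\<And>r. 0 \<le> r \<Longrightarrow> 0 \<le> w r"
    and "\<And>r. 0 \<le> r \<Longrightarrow> \<Phi> r = r powr \<nu> * w r powr (p - 1)"
proof -
  have abs\<Phi>: "\<bar>\<Phi> r\<bar> = r powr \<nu> * \<bar>w r\<bar> powr (p - 1)" for r
  proof (cases "w r = 0")
    case False
    then have "\<bar>w r\<bar> powr (p - 1) = \<bar>w r\<bar> powr (p - 2) * \<bar>w r\<bar>"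
      using powr_add[of "\<bar>w r\<bar>" "p - 2" 1] by simp
    then show ?thesis by (simp add: \<Phi>_def abs_mult)
  qed (simp add: \<Phi>_def)
  have "continuous_on {0..} (\<lambda>r. \<bar>\<Phi> r\<bar>)"
    unfolding abs\<Phi> using p \<nu> w
    by (intro continuous_on_mult continuous_on_powr' continuous_intros) auto
  then have "((\<lambda>r. \<bar>\<Phi> r\<bar>) \<longlongrightarrow> \<bar>\<Phi> 0\<bar>) (at 0 within {0..})"
    by (simp add: continuous_on_def)
  moreover have \<Phi>0: "\<Phi> 0 = 0" by (simp add: \<Phi>_def)
  ultimately have "(\<Phi> \<longlongrightarrow> 0) (at 0 within {0..})"
    by (simp add: tendsto_rabs_zero_iff)
  then have "continuous (at 0 within {0..}) \<Phi>" by (simp add: continuous_within \<Phi>0)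
  moreover have "continuous (at r within {0..}) \<Phi>" if "0 < r" for r
    using deriv[OF that] by (auto intro: DERIV_isCont continuous_at_imp_continuous_at_within)
  ultimately show cont: "continuous_on {0..} \<Phi>"
    by (metis atLeast_iff continuous_on_eq_continuous_within less_eq_real_def)
  show mono: "\<Phi> r \<le> \<Phi> s" if "0 \<le> r" "r \<le> s" for r s
    using that(2)
  proof (rule DERIV_nonneg_imp_increasing_open)
    fix t assume "r < t" "t < s"
    then show "\<exists>y. (\<Phi> has_real_derivative y) (at t) \<and> 0 \<le> y"
      using that deriv[of t] d[of t] by auto
  qed (use that in \<open>auto intro: continuous_on_subset[OF cont]\<close>)
  show nonneg: "0 \<le> \<Phi> r" if "0 \<le> r" for r
    using mono[of 0 r] that \<Phi>0 by simp
  show w_nonneg: "0 \<le> w r" if "0 \<le> r" for r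
  proof (rule ccontr)
    assume "\<not> 0 \<le> w r"
    moreover from this have "0 < r" using w(2) that by (cases "r = 0") auto
    ultimately have "\<Phi> r < 0" unfolding \<Phi>_def by (intro mult_pos_neg) auto
    then show False using nonneg[OF that] by simp
  qed
  show "\<Phi> r = r powr \<nu> * w r powr (p - 1)" if "0 \<le> r" for r
    using abs\<Phi>[of r] nonneg[OF that] w_nonneg[OF that] by simp
qed

context system_exponents
begin

text \<open>For \<open>\<alpha> > 0\<close> the equation for \<open>u\<close> does not determine the slope, because \<open>w = 0\<close> solves it too.
Being non-constant near the origin excludes this: the flux \<open>\<Phi>\<close> is positive for \<open>r > 0\<close> by
monotonicity, so \<open>\<Phi>\<^sup>\<theta>\<close> may be differentiated and its derivative is \<open>s\<^sup>\<kappa>\<close> times \<open>source_u V\<close>.\<close>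

lemma slope_u_eqI:
  assumes V: "admissible V" and w: "continuous_on {0..} w" "w 0 = 0"
    and ode: "\<And>r. 0 < r \<Longrightarrow> ((\<lambda>r. r powr \<nu> * (\<bar>w r\<bar> powr (p - 2) * w r)) has_real_derivative
        r powr \<nu> * (rpow (V r) m * rpow \<bar>w r\<bar> \<alpha>)) (at r)"
    and nonvanishing: "\<And>\<epsilon>. 0 < \<epsilon> \<Longrightarrow> \<exists>r. 0 < r \<and> r < \<epsilon> \<and> w r \<noteq> 0"
    and r: "0 \<le> r"
  shows "w r = slope_u V r"
proof -
  define \<Phi> where "\<Phi> r = r powr \<nu> * (\<bar>w r\<bar> powr (p - 2) * w r)" for r
  have "0 \<le> r powr \<nu> * (rpow (V r) m * rpow \<bar>w r\<bar> \<alpha>)" for r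
    by (simp add: rpow_def)
  note \<Phi> = flux_monotone[OF p \<nu> w ode this, folded \<Phi>_def]
  have w_pos: "0 < w r" if r: "0 < r" for r
  proof -
    obtain s where s: "0 < s" "s < r" "w s \<noteq> 0" using nonvanishing[OF r] by auto
    then have "\<Phi> s \<noteq> 0" by (simp add: \<Phi>_def)
    then have "0 < \<Phi> r" using \<Phi>(2)[of s r] \<Phi>(3)[of s] s by simp
    then have "w r \<noteq> 0" by (auto simp: \<Phi>_def)
    then show ?thesis using \<Phi>(4)[of r] r by simp
  qed
  have \<theta>_diff: "(p - 1) * (\<theta> - 1) = - \<alpha>" and \<theta>_mult: "(p - 1) * \<theta> = p - 1 - \<alpha>"
    using p by (simp_all add: \<theta>_def field_simps)
  have "\<Phi> r powr \<theta> = \<Phi> 0 powr \<theta> + integral {0..r} (\<lambda>s. s powr \<kappa> * source_u V s)"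
  proof (rule eq_integral_from_0[OF _ _ r])
    show "continuous_on {0..} (\<lambda>r. \<Phi> r powr \<theta>)"
      using \<theta>_pos \<Phi>(1,3) by (intro continuous_on_powr') (auto intro: continuous_intros)
    fix t :: real assume t: "0 < t"
    have \<Phi>_pos: "0 < \<Phi> t" using \<Phi>(5)[of t] w_pos[OF t] t by simp
    have "V t > 0" using V t by (simp add: admissible_def)
    have "((\<lambda>r. \<Phi> r powr \<theta>) has_real_derivative
        \<theta> * \<Phi> t powr (\<theta> - 1) * (t powr \<nu> * (rpow (V t) m * rpow \<bar>w t\<bar> \<alpha>))) (at t)"
      by (rule DERIV_chain2[OF has_real_derivative_powr[OF \<Phi>_pos] ode[OF t, folded \<Phi>_def]])
    moreover have "\<Phi> t powr (\<theta> - 1) = t powr (\<nu> * (\<theta> - 1)) * w t powr (- \<alpha>)"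
      using \<Phi>(5)[of t] w_pos[OF t] t by (simp add: powr_mult powr_powr \<theta>_diff)
    moreover have "rpow \<bar>w t\<bar> \<alpha> = w t powr \<alpha>" "rpow (V t) m = V t powr m"
      using w_pos[OF t] m by (simp_all add: rpow_def)
    moreover have "t powr \<kappa> = t powr (\<nu> * (\<theta> - 1)) * t powr \<nu>"
      by (simp add: \<kappa>_def algebra_simps flip: powr_add)
    moreover have "w t powr (- \<alpha>) * w t powr \<alpha> = 1"
      using w_pos[OF t] by (simp flip: powr_add)
    \<comment> \<open>The factor \<open>w\<^sup>-\<^sup>\<alpha>\<close> from the chain rule cancels the factor \<open>w\<^sup>\<alpha>\<close> of the equation.\<close>
    moreover have "\<theta> * (x * y) * (z * (d * y')) = (x * z) * (\<theta> * d)" if "y * y' = 1" for x y z d y'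
    proof -
      have "\<theta> * (x * y) * (z * (d * y')) = (x * z) * (\<theta> * d) * (y * y')" by (simp only: mult_ac)
      then show ?thesis using that by simp
    qed
    ultimately show "((\<lambda>r. \<Phi> r powr \<theta>) has_real_derivative t powr \<kappa> * source_u V t) (at t)"
      by (simp only: source_u_def)
  qed
  then have *: "\<Phi> r powr \<theta> = integral {0..r} (\<lambda>s. s powr \<kappa> * source_u V s)"
    by (simp add: \<Phi>_def)
  show ?thesis
  proof (cases "r = 0")
    case True
    then show ?thesis using w(2) slope_u_0[OF V] by simp
  next
    case False
    with r have r: "0 < r" by simp
    have "\<Phi> r powr \<theta> = r powr \<kappa> * w r powr (p - 1 - \<alpha>)"
      using \<Phi>(5)[of r] w_pos[OF r] r by (simp add: powr_mult powr_powr \<theta>_mult \<kappa>_def)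
    then have "wmean \<kappa> (source_u V) r = w r powr (p - 1 - \<alpha>)"
      using r by (simp add: wmean_def powr_minus flip: *)
    then show ?thesis
      using \<alpha>_less w_pos[OF r] by (simp add: slope_u_def powr_powr g_def)
  qed
qed

lemma slope_v_eqI:
  assumes V: "admissible V" and w: "continuous_on {0..} w" "w 0 = 0"
    and ode: "\<And>r. 0 < r \<Longrightarrow> ((\<lambda>r. r powr \<nu> * (\<bar>w r\<bar> powr (p - 2) * w r)) has_real_derivative
        r powr \<nu> * (rpow (V r) \<beta> * rpow (slope_u V r) q)) (at r)"
    and r: "0 \<le> r"
  shows "w r = slope_v V r"
proof -
  define \<Phi> where "\<Phi> r = r powr \<nu> * (\<bar>w r\<bar> powr (p - 2) * w r)" for r
  have "0 \<le> r powr \<nu> * (rpow (V r) \<beta> * rpow (slope_u V r) q)" for r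
    by (simp add: rpow_def)
  note \<Phi> = flux_monotone[OF p \<nu> w ode this, folded \<Phi>_def]
  have "\<Phi> r = \<Phi> 0 + integral {0..r} (\<lambda>s. s powr \<nu> * source_v V s)"
  proof (rule eq_integral_from_0[OF \<Phi>(1) _ r])
    fix t :: real assume t: "0 < t"
    then have "rpow (V t) \<beta> * rpow (slope_u V t) q = source_v V t"
      using V q by (auto simp: rpow_def source_v_def admissible_def less_imp_neq[symmetric])
    then show "(\<Phi> has_real_derivative t powr \<nu> * source_v V t) (at t)"
      using ode[OF t, folded \<Phi>_def] by simp
  qed
  then have "r powr \<nu> * w r powr (p - 1) = integral {0..r} (\<lambda>s. s powr \<nu> * source_v V s)"
    using \<Phi>(5)[of r] r by (simp add: \<Phi>_def)
  then have "wmean \<nu> (source_v V) r = w r powr (p - 1)" if "r \<noteq> 0"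
    using r that by (simp add: wmean_def powr_minus flip: \<open>_ = integral _ _\<close>)
  then show ?thesis
    using p \<Phi>(4)[of r] r w(2) slope_v_0[OF V] by (cases "r = 0") (simp_all add: slope_v_def powr_powr)
qed

theorem solution_imp_fixed_point:
  fixes u v :: "real^'n \<Rightarrow> real"
  assumes dim: "\<nu> = real CARD('n) - 1" and C1: "C1_on UNIV u" "C1_on UNIV v"
    and sol: "nonconst_pos_radial_system p m q \<alpha> \<beta> u v"
  obtains V where "admissible V" "\<And>r. 0 \<le> r \<Longrightarrow> V r = integral_op (v 0) V r"
    "v = (\<lambda>x. V (norm x))" "u = (\<lambda>x. u 0 + integral {0..norm x} (slope_u V))"
proof -
  obtain U w where U: "radial_slope U w" "u = (\<lambda>x. U (norm x))"
    using radial_slope_of_C1[OF C1(1)] sol by (auto simp: nonconst_pos_radial_system_def)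
  obtain V z where V: "radial_slope V z" "v = (\<lambda>x. V (norm x))"
    using radial_slope_of_C1[OF C1(2)] sol by (auto simp: nonconst_pos_radial_system_def)
  interpret U: radial_slope U w by fact
  interpret V: radial_slope V z by fact
  \<comment> \<open>Each radius is attained, so facts about points of the space become facts about profiles.\<close>
  define e :: "real \<Rightarrow> real^'n" where "e r = r *\<^sub>R axis undefined 1" for r
  have e: "norm (e r) = r" "e r \<noteq> 0" if "0 < r" for r
    using that by (auto simp: e_def axis_eq_0_iff)
  have e': "\<exists>x::real^'n. norm x = r" if "0 \<le> r" for r
    using that by (intro exI[of _ "e r"]) (simp add: e_def)
  have "0 < V (norm x)" for x :: "real^'n"
    using sol by (simp add: nonconst_pos_radial_system_def V(2))
  then have "0 < V r" if "0 \<le> r" for r using e'[OF that] by metis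
  then have adm: "admissible V"
    unfolding admissible_def by (auto intro: DERIV_continuous_on[OF V.U_deriv])
  note sys = sol[unfolded nonconst_pos_radial_system_def satisfies_system_def U(2) V(2)]
  have w: "w r = slope_u V r" if "0 \<le> r" for r
  proof (rule slope_u_eqI[OF adm U.w_cont U.w_0 _ _ that])
    fix r :: real assume r: "0 < r"
    from sys e[OF r] show "((\<lambda>r. r powr \<nu> * (\<bar>w r\<bar> powr (p - 2) * w r)) has_real_derivative
        r powr \<nu> * (rpow (V r) m * rpow \<bar>w r\<bar> \<alpha>)) (at r)"
      using U.p_flux_radial_ode[of "e r" p] by (simp add: dim U.norm_grad_radial)
  next
    fix \<epsilon> :: real assume "0 < \<epsilon>"
    then show "\<exists>r. 0 < r \<and> r < \<epsilon> \<and> w r \<noteq> 0"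
      using radial_slope_not_vanishing[OF U(1), where 'n='n] sys by auto
  qed
  have z: "z r = slope_v V r" if "0 \<le> r" for r
  proof (rule slope_v_eqI[OF adm V.w_cont V.w_0 _ that])
    fix r :: real assume r: "0 < r"
    from sys e[OF r] show "((\<lambda>r. r powr \<nu> * (\<bar>z r\<bar> powr (p - 2) * z r)) has_real_derivative
        r powr \<nu> * (rpow (V r) \<beta> * rpow (slope_u V r) q)) (at r)"
      using V.p_flux_radial_ode[of "e r" p] w[of r] r slope_u_nonneg[OF adm, of r]
      by (simp add: dim U.norm_grad_radial)
  qed
  have V_eq: "V r = V 0 + integral {0..r} (slope_v V)" if r: "0 \<le> r" for r
    using V.U_deriv z r by (intro eq_integral_from_0 DERIV_continuous_on[OF V.U_deriv])
      (auto simp flip: at_within_atLeast_0)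
  have U_eq: "U r = U 0 + integral {0..r} (slope_u V)" if r: "0 \<le> r" for r
    using U.U_deriv w r by (intro eq_integral_from_0 DERIV_continuous_on[OF U.U_deriv])
      (auto simp flip: at_within_atLeast_0)
  show ?thesis
  proof (rule that[OF adm _ V(2)])
    show "V r = integral_op (v 0) V r" if "0 \<le> r" for r
      using V_eq[OF that] by (simp add: integral_op_def V(2))
    show "u = (\<lambda>x. u 0 + integral {0..norm x} (slope_u V))"
      unfolding U(2) norm_zero by (intro ext U_eq norm_ge_zero)
  qed
qed

end

section \<open>From the fixed point to solutions\<close>

lemma (in radial_slope) p_laplace_radial:
  fixes x :: "real^'n"
  assumes "x \<noteq> 0" and "((\<lambda>r. \<bar>w r\<bar> powr (p - 2) * w r) has_real_derivative \<phi>') (at (norm x))"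
  shows "p_flux p (\<lambda>y. U (norm y)) differentiable (at x)"
    and "p_laplace p (\<lambda>y. U (norm y)) x
      = \<phi>' + (real CARD('n) - 1) * (\<bar>w (norm x)\<bar> powr (p - 2) * w (norm x) / norm x)"
  unfolding p_laplace_def p_flux_radial using divergence_radial_flux[OF assms] by auto

lemma (in radial_slope) p_laplace_radial_0:
  assumes "((\<lambda>r. \<bar>w r\<bar> powr (p - 2) * w r / r) \<longlongrightarrow> L) (at_right 0)"
  shows "p_flux p (\<lambda>y::real^'n. U (norm y)) differentiable (at 0)"
    and "p_laplace p (\<lambda>y::real^'n. U (norm y)) 0 = real CARD('n) * L"
  unfolding p_laplace_def p_flux_radial
  using differentiableI[OF radial_field_has_derivative_0[OF assms]] divergence_radial_field_0[OF assms]
  by auto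

lemma nonconstant_near_0_radial:
  assumes "\<And>r. 0 < r \<Longrightarrow> U r \<noteq> U 0"
  shows "nonconstant_near_0 (\<lambda>x::real^'n. U (norm x))"
  unfolding nonconstant_near_0_def
proof (intro allI impI notI)
  fix S :: "(real^'n) set"
  assume S: "open S \<and> 0 \<in> S" and const: "(\<lambda>x. U (norm x)) constant_on S"
  then obtain \<epsilon> where \<epsilon>: "0 < \<epsilon>" "ball 0 \<epsilon> \<subseteq> S" by (auto simp: open_contains_ball)
  define x :: "real^'n" where "x = (\<epsilon> / 2) *\<^sub>R axis undefined 1"
  have "norm x = \<epsilon> / 2" using \<epsilon> by (simp add: x_def)
  then have "x \<in> S" "0 < norm x" using \<epsilon> by auto
  then show False using const S assms[of "norm x"] by (force simp: constant_on_def)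
qed

lemma rpow_eq_powr: "0 < t \<Longrightarrow> rpow t s = t powr s"
  by (simp add: rpow_def)

text \<open>A slope that is a power of a mean makes the flux a power of the same mean.\<close>

lemma flux_powr:
  fixes A :: real
  assumes "1 < p" "0 \<le> A"
  shows "\<bar>A powr e\<bar> powr (p - 2) * A powr e = A powr (e * (p - 1))"
  using assms by (simp add: powr_powr algebra_simps flip: powr_add)

context system_exponents
begin

definition profile_u :: "real \<Rightarrow> (real \<Rightarrow> real) \<Rightarrow> real \<Rightarrow> real" where
  "profile_u a V r = a + integral {0..r} (slope_u V)"

definition slope_u_deriv :: "(real \<Rightarrow> real) \<Rightarrow> real \<Rightarrow> real" where
  "slope_u_deriv V r = g * wmean \<kappa> (source_u V) r powr (g - 1)
     * (source_u V r - \<kappa> * (wmean \<kappa> (source_u V) r / r))"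

definition slope_v_deriv :: "(real \<Rightarrow> real) \<Rightarrow> real \<Rightarrow> real" where
  "slope_v_deriv V r = 1 / (p - 1) * wmean \<nu> (source_v V) r powr (1 / (p - 1) - 1)
     * (source_v V r - \<nu> * (wmean \<nu> (source_v V) r / r))"

context
  fixes V :: "real \<Rightarrow> real" and a b :: real
  assumes V: "admissible V" and a: "0 < a" and b: "0 < b"
    and fixed: "\<And>r. 0 \<le> r \<Longrightarrow> V r = integral_op b V r"
begin

lemma V_0: "V 0 = b"
  using fixed[of 0] by (simp add: integral_op_def)

lemma profile_u_slope: "radial_slope (profile_u a V) (slope_u V)"
proof
  fix r :: real assume "0 \<le> r"
  then show "(profile_u a V has_real_derivative slope_u V r) (at r within {0..})"
    unfolding profile_u_def
    by (auto intro!: derivative_eq_intros has_real_derivative_integral_from_0 slope_u_cont[OF V])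
qed (auto intro: slope_u_cont[OF V] slope_u_0[OF V])

lemma profile_v_slope: "radial_slope V (slope_v V)"
proof
  fix r :: real assume "0 \<le> r"
  from integral_op_deriv[OF V this, of b]
  show "(V has_real_derivative slope_v V r) (at r within {0..})"
    by (rule has_field_derivative_transform_within[where d=1]) (use \<open>0 \<le> r\<close> in \<open>auto simp: fixed\<close>)
qed (auto intro: slope_v_cont[OF V] slope_v_0[OF V])

lemma source_u_asymp: "((\<lambda>r. source_u V r / r powr 0) \<longlongrightarrow> \<theta> * b powr m) (at_right 0)"
proof -
  have "(source_u V \<longlongrightarrow> source_u V 0) (at 0 within {0..})"
    using source_u_cont[OF V] by (simp add: continuous_on_def)
  then have "(source_u V \<longlongrightarrow> source_u V 0) (at_right 0)"
    by (rule tendsto_within_subset) auto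
  then have "(source_u V \<longlongrightarrow> \<theta> * b powr m) (at_right 0)"
    by (simp add: source_u_def V_0)
  then show ?thesis
    by (rule Lim_transform_eventually)
      (use eventually_at_right_less[of 0] in \<open>eventually_elim, auto\<close>)
qed

text \<open>The slope of \<open>u\<close> vanishes at the origin to the order \<open>g\<close>, and \<open>v\<close> tends to \<open>b\<close> there, so the source
of \<open>v\<close> vanishes to the order \<open>q g\<close>.\<close>

lemma source_v_asymp: "\<exists>c>0. ((\<lambda>r. source_v V r / r powr (q * g)) \<longlongrightarrow> c) (at_right 0)"
proof -
  define K where "K = \<theta> * b powr m / (\<kappa> + 1)"
  have K: "0 < K" using \<theta>_pos \<kappa>_pos b by (simp add: K_def)
  have "((\<lambda>r. wmean \<kappa> (source_u V) r / r powr 1) \<longlongrightarrow> K) (at_right 0)"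
    using wmean_asymp[OF \<kappa>_pos source_u_cont[OF V] _ source_u_asymp] by (simp add: K_def)
  moreover have "(V \<longlongrightarrow> b) (at_right 0)"
  proof -
    have "(V \<longlongrightarrow> V 0) (at 0 within {0..})"
      using V by (simp add: admissible_def continuous_on_def)
    then show ?thesis unfolding V_0 by (rule tendsto_within_subset) auto
  qed
  ultimately have "((\<lambda>r. V r powr \<beta> * (wmean \<kappa> (source_u V) r / r powr 1) powr (g * q)) \<longlongrightarrow>
      b powr \<beta> * K powr (g * q)) (at_right 0)"
    using b K by (intro tendsto_mult tendsto_powr tendsto_const) auto
  moreover have "\<forall>\<^sub>F r in at_right 0. V r powr \<beta> * (wmean \<kappa> (source_u V) r / r powr 1) powr (g * q)
      = source_v V r / r powr (q * g)"
    using eventually_at_right_less[of 0]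
  proof eventually_elim
    case (elim r)
    then show ?case
      using wmean_pos[OF \<kappa>_pos source_u_cont[OF V] source_u_pos[OF V], of r]
      by (simp add: source_v_def slope_u_def powr_divide powr_powr mult_ac)
  qed
  ultimately have "((\<lambda>r. source_v V r / r powr (q * g)) \<longlongrightarrow> b powr \<beta> * K powr (g * q)) (at_right 0)"
    by (rule Lim_transform_eventually)
  moreover have "0 < b powr \<beta> * K powr (g * q)"
    using b K by simp
  ultimately show ?thesis by blast
qed

lemma slope_u_has_deriv: "0 < r \<Longrightarrow> (slope_u V has_real_derivative slope_u_deriv V r) (at r)"
  unfolding slope_u_def[abs_def] slope_u_deriv_def
  by (rule wmean_powr_has_real_derivative[OF \<kappa>_pos source_u_cont[OF V] source_u_pos[OF V]]) auto

lemma slope_v_has_deriv: "0 < r \<Longrightarrow> (slope_v V has_real_derivative slope_v_deriv V r) (at r)"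
  unfolding slope_v_def[abs_def] slope_v_deriv_def
  by (rule wmean_powr_has_real_derivative[OF \<nu> source_v_cont[OF V] source_v_pos[OF V]]) auto

lemma slope_u_deriv_cont: "continuous_on {0<..} (slope_u_deriv V)"
  unfolding slope_u_deriv_def[abs_def]
  by (rule continuous_on_wmean_powr_deriv[OF \<kappa>_pos source_u_cont[OF V] source_u_pos[OF V]]) auto

lemma slope_v_deriv_cont: "continuous_on {0<..} (slope_v_deriv V)"
  unfolding slope_v_deriv_def[abs_def]
  by (rule continuous_on_wmean_powr_deriv[OF \<nu> source_v_cont[OF V] source_v_pos[OF V]]) auto

text \<open>Away from the origin this reverses the derivation of \<open>slope_u\<close>: the flux is \<open>A\<^sup>1\<^sup>/\<^sup>\<theta>\<close> for the weighted
mean \<open>A\<close> of \<open>source_u V\<close>, and \<open>\<kappa> = \<nu> \<theta>\<close> makes the terms with \<open>A\<^sup>1\<^sup>/\<^sup>\<theta> / r\<close> cancel. At the origin the flux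
vanishes to the order \<open>1 / \<theta> \<ge> 1\<close>, with equality exactly for \<open>\<alpha> = 0\<close>; only then is the divergence
nonzero there, in accordance with \<open>\<bar>\<nabla>u\<bar>\<^sup>\<alpha>\<close> being absent from the equation.\<close>

lemma p_laplace_u:
  fixes x :: "real^'n"
  assumes dim: "\<nu> = real CARD('n) - 1"
  shows "p_flux p (\<lambda>y. profile_u a V (norm y)) differentiable (at x)"
    and "p_laplace p (\<lambda>y. profile_u a V (norm y)) x
      = rpow (V (norm x)) m * rpow (slope_u V (norm x)) \<alpha>"
proof -
  interpret radial_slope "profile_u a V" "slope_u V" by (rule profile_u_slope)
  let ?A = "wmean \<kappa> (source_u V)"
  have gp: "g * (p - 1) = 1 / \<theta>" by (simp add: g_def \<theta>_def)
  have flux: "\<bar>slope_u V r\<bar> powr (p - 2) * slope_u V r = ?A r powr (1 / \<theta>)" for r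
    unfolding slope_u_def gp[symmetric]
    using flux_powr[OF p wmean_nonneg[OF \<kappa>_pos source_u_cont[OF V]]] source_u_pos[OF V]
    by (simp add: less_imp_le)
  have A_pos: "0 < ?A r" if "0 < r" for r
    using wmean_pos[OF \<kappa>_pos source_u_cont[OF V] source_u_pos[OF V]] that by simp
  have "p_flux p (\<lambda>y. profile_u a V (norm y)) differentiable (at x) \<and>
    p_laplace p (\<lambda>y. profile_u a V (norm y)) x = rpow (V (norm x)) m * rpow (slope_u V (norm x)) \<alpha>"
  proof (cases "x = 0")
    case True
    define L where "L = (if (0 + 1) * (1 / \<theta>) = 1
      then (\<theta> * b powr m / (\<kappa> + 0 + 1)) powr (1 / \<theta>) else 0)"
    have "((\<lambda>r. ?A r powr (1 / \<theta>) / r) \<longlongrightarrow> L) (at_right 0)"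
      unfolding L_def
    proof (rule wmean_powr_asymp(1)[OF \<kappa>_pos source_u_cont[OF V] source_u_pos[OF V] _ _ source_u_asymp])
      show "1 \<le> (0 + 1) * (1 / \<theta>)" using p \<alpha>_less \<alpha>_nonneg by (simp add: \<theta>_def field_simps)
    qed (use \<theta>_pos b in auto)
    note p_laplace_radial_0[where 'n='n and p=p, unfolded flux, OF this]
    moreover have "real CARD('n) * L = rpow b m * rpow 0 \<alpha>"
    proof (cases "\<alpha> = 0")
      case True
      have "\<theta> = 1" unfolding \<theta>_def using True p by simp
      moreover from this have "\<kappa> = \<nu>" by (simp add: \<kappa>_def)
      then have "\<kappa> + 1 = real CARD('n)" using dim by linarith
      ultimately have "L = b powr m / real CARD('n)" using b by (simp add: L_def)
      then show ?thesis using True m by (simp add: rpow_def)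
    next
      case False
      then have "\<theta> \<noteq> 1" using p \<alpha>_less by (auto simp: \<theta>_def field_simps)
      then show ?thesis using False by (simp add: L_def rpow_def)
    qed
    ultimately show ?thesis using True by (simp add: V_0 slope_u_0[OF V])
  next
    case False
    define r where "r = norm x"
    have r: "0 < r" using False by (simp add: r_def)
    note * = p_laplace_radial[where p=p, OF False, unfolded flux,
        OF wmean_powr_has_real_derivative[OF \<kappa>_pos source_u_cont[OF V] source_u_pos[OF V]],
        folded r_def, OF less_imp_le r]
    have "1 / \<theta> * ?A r powr (1 / \<theta> - 1) * (source_u V r - \<kappa> * (?A r / r)) + \<nu> * (?A r powr (1 / \<theta>) / r)
        = ?A r powr (1 / \<theta> - 1) * V r powr m"
    proof -
      have "?A r powr (1 / \<theta>) = ?A r powr (1 / \<theta> - 1) * ?A r"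
        using A_pos[OF r] by (simp add: powr_diff)
      then show ?thesis using \<theta>_pos r by (simp add: source_u_def \<kappa>_def field_simps)
    qed
    moreover have "1 / \<theta> - 1 = g * \<alpha>" using \<alpha>_less by (simp add: \<theta>_def g_def field_simps)
    moreover have "?A r powr (g * \<alpha>) = rpow (slope_u V r) \<alpha>"
      unfolding rpow_eq_powr[OF slope_u_pos[OF V r]] by (simp add: slope_u_def powr_powr)
    ultimately show ?thesis
      using * m by (simp add: r_def rpow_def flip: dim)
  qed
  then show "p_flux p (\<lambda>y. profile_u a V (norm y)) differentiable (at x)"
    "p_laplace p (\<lambda>y. profile_u a V (norm y)) x = rpow (V (norm x)) m * rpow (slope_u V (norm x)) \<alpha>"
    by auto
qed

text \<open>The flux of \<open>v\<close> is itself a weighted mean, with weight exponent \<open>\<nu>\<close>, so its divergence is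
\<open>source_v V\<close>. At the origin it vanishes to the order \<open>q g + 1 > 1\<close> and both sides are zero.\<close>

lemma p_laplace_v:
  fixes x :: "real^'n"
  assumes dim: "\<nu> = real CARD('n) - 1"
  shows "p_flux p (\<lambda>y. V (norm y)) differentiable (at x)"
    and "p_laplace p (\<lambda>y. V (norm y)) x
      = rpow (V (norm x)) \<beta> * rpow (slope_u V (norm x)) q"
proof -
  interpret radial_slope V "slope_v V" by (rule profile_v_slope)
  let ?A = "wmean \<nu> (source_v V)"
  have A_nonneg: "0 \<le> ?A r" for r
    by (rule wmean_nonneg[OF \<nu> source_v_cont[OF V] source_v_nonneg[OF V]])
  have flux: "\<bar>slope_v V r\<bar> powr (p - 2) * slope_v V r = ?A r" for r
    unfolding slope_v_def using flux_powr[OF p A_nonneg, of _ "1 / (p - 1)"] p A_nonneg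
    by simp
  have "p_flux p (\<lambda>y. V (norm y)) differentiable (at x) \<and>
    p_laplace p (\<lambda>y. V (norm y)) x = rpow (V (norm x)) \<beta> * rpow (slope_u V (norm x)) q"
  proof (cases "x = 0")
    case True
    obtain c where c: "0 < c" "((\<lambda>r. source_v V r / r powr (q * g)) \<longlongrightarrow> c) (at_right 0)"
      using source_v_asymp by blast
    have qg: "0 < q * g" using q g_pos by simp
    have "((\<lambda>r. ?A r powr 1 / r) \<longlongrightarrow> 0) (at_right 0)"
      using wmean_powr_asymp(1)[OF \<nu> source_v_cont[OF V] source_v_pos[OF V] _ c, of 1] qg q g_pos by simp
    then have "((\<lambda>r. ?A r / r) \<longlongrightarrow> 0) (at_right 0)" using A_nonneg by simp
    note * = p_laplace_radial_0[where 'n='n and p=p, unfolded flux, OF this]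
    then show ?thesis using q True by (simp add: rpow_def slope_u_0[OF V])
  next
    case False
    define r where "r = norm x"
    have r: "0 < r" using False by (simp add: r_def)
    note * = p_laplace_radial[where p=p, OF False, unfolded flux,
        OF wmean_has_real_derivative[OF \<nu> source_v_cont[OF V]], folded r_def, OF r]
    have "source_v V r = rpow (V r) \<beta> * rpow (slope_u V r) q"
      using V r q by (auto simp: rpow_def source_v_def admissible_def less_imp_neq[symmetric])
    then show ?thesis using * by (simp add: r_def flip: dim)
  qed
  then show "p_flux p (\<lambda>y. V (norm y)) differentiable (at x)"
    "p_laplace p (\<lambda>y. V (norm y)) x = rpow (V (norm x)) \<beta> * rpow (slope_u V (norm x)) q"
    by auto
qed

text \<open>At the origin the slopes have the orders \<open>g\<close> and \<open>(q g + 1) / (p - 1)\<close>. The two conditions for the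
second-order regularity say that these are at least one.\<close>

theorem fixed_point_imp_solution:
  fixes u v :: "real^'n \<Rightarrow> real"
  assumes dim: "\<nu> = real CARD('n) - 1"
  defines "u \<equiv> \<lambda>x. profile_u a V (norm x)" and "v \<equiv> \<lambda>x. V (norm x)"
  shows "radial_solution p m q \<alpha> \<beta> u v" and "u 0 = a" and "v 0 = b"
    and "p - 2 \<le> \<alpha> \<Longrightarrow> (p - 2) * (p - 1 - \<alpha>) \<le> q \<Longrightarrow> C2_radial_solution p m q \<alpha> \<beta> u v"
proof -
  interpret U: radial_slope "profile_u a V" "slope_u V" by (rule profile_u_slope)
  interpret V: radial_slope V "slope_v V" by (rule profile_v_slope)
  have u_gt: "a < profile_u a V r" if "0 < r" for r
    using integral_from_0_pos[OF slope_u_cont[OF V] slope_u_pos[OF V] that] by (simp add: profile_u_def)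
  have u_0: "profile_u a V 0 = a" by (simp add: profile_u_def)
  have v_gt: "b < V r" if "0 < r" for r
    using integral_from_0_pos[OF slope_v_cont[OF V] slope_v_pos[OF V] that] that
    by (simp add: integral_op_def fixed)
  have "0 < profile_u a V (norm x)" for x :: "real^'n"
    using u_gt[of "norm x"] u_0 a by (cases "x = 0") auto
  moreover have "0 < V (norm x)" for x :: "real^'n"
    using V by (simp add: admissible_def)
  moreover have "nonconstant_near_0 u" "nonconstant_near_0 v"
    unfolding u_def v_def using u_gt v_gt
    by (auto intro!: nonconstant_near_0_radial simp: u_0 V_0 less_imp_neq[symmetric])
  moreover have "satisfies_system p m q \<alpha> \<beta> u v"
    using p_laplace_u[OF dim] p_laplace_v[OF dim]
    by (simp add: satisfies_system_def u_def v_def U.norm_grad_radial slope_u_nonneg[OF V])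
  ultimately have sys: "nonconst_pos_radial_system p m q \<alpha> \<beta> u v"
    by (simp add: nonconst_pos_radial_system_def u_def v_def radially_symmetric_def)
  show "radial_solution p m q \<alpha> \<beta> u v"
    unfolding radial_solution_def u_def v_def using sys
    by (auto simp: u_def v_def intro!: U.radial_C1 V.radial_C1
        U.radial_C2_away_from_0[OF slope_u_has_deriv slope_u_deriv_cont]
        V.radial_C2_away_from_0[OF slope_v_has_deriv slope_v_deriv_cont])
  show "u 0 = a" "v 0 = b" by (simp_all add: u_def v_def u_0 V_0)
  show "C2_radial_solution p m q \<alpha> \<beta> u v"
    if "p - 2 \<le> \<alpha>" "(p - 2) * (p - 1 - \<alpha>) \<le> q"
  proof -
    have "1 \<le> (0 + 1) * g" using that \<alpha>_less by (simp add: g_def)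
    note u_asymp = wmean_powr_asymp[OF \<kappa>_pos source_u_cont[OF V] source_u_pos[OF V] _ _ source_u_asymp this,
        folded slope_u_def slope_u_deriv_def]
    have "C2_on UNIV u"
      unfolding u_def using \<theta>_pos b
      by (intro U.radial_C2[OF slope_u_has_deriv slope_u_deriv_cont u_asymp]) auto
    moreover have "C2_on UNIV v"
    proof -
      obtain c where c: "0 < c" "((\<lambda>r. source_v V r / r powr (q * g)) \<longlongrightarrow> c) (at_right 0)"
        using source_v_asymp by blast
      have "p - 2 \<le> q * g" using that \<alpha>_less by (simp add: g_def field_simps)
      then have "1 \<le> (q * g + 1) * (1 / (p - 1))" using p by (simp add: field_simps)
      note v_asymp = wmean_powr_asymp[OF \<nu> source_v_cont[OF V] source_v_pos[OF V] _ c this,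
          folded slope_v_def slope_v_deriv_def]
      show ?thesis
        unfolding v_def using q g_pos
        by (intro V.radial_C2[OF slope_v_has_deriv slope_v_deriv_cont v_asymp]) auto
    qed
    ultimately show ?thesis using sys by (simp add: C2_radial_solution_def)
  qed
qed

end

text \<open>A solution of class \<open>C\<^sup>2\<close> is one of the larger class as well, so uniqueness in the larger class
  covers both claims.\<close>

lemma solution_unique:
  fixes u v u' v' :: "real^'n \<Rightarrow> real"
  assumes dim: "\<nu> = real CARD('n) - 1" and b: "0 < b"
    and sol: "radial_solution p m q \<alpha> \<beta> u v" "u 0 = a" "v 0 = b"
    and sol': "radial_solution p m q \<alpha> \<beta> u' v'" "u' 0 = a" "v' 0 = b"
  shows "u = u' \<and> v = v'"
proof -
  have reg: "C1_on UNIV u" "C1_on UNIV v" "nonconst_pos_radial_system p m q \<alpha> \<beta> u v"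
    "C1_on UNIV u'" "C1_on UNIV v'" "nonconst_pos_radial_system p m q \<alpha> \<beta> u' v'"
    using sol(1) sol'(1) by (auto simp: radial_solution_def)
  obtain V where V: "admissible V" "\<And>r. 0 \<le> r \<Longrightarrow> V r = integral_op b V r"
    "v = (\<lambda>x. V (norm x))" "u = (\<lambda>x. a + integral {0..norm x} (slope_u V))"
    using solution_imp_fixed_point[OF dim reg(1-3)] sol(2,3) by metis
  obtain W where W: "admissible W" "\<And>r. 0 \<le> r \<Longrightarrow> W r = integral_op b W r"
    "v' = (\<lambda>x. W (norm x))" "u' = (\<lambda>x. a + integral {0..norm x} (slope_u W))"
    using solution_imp_fixed_point[OF dim reg(4-6)] sol'(2,3) by metis
  have eq: "V r = W r" if "0 \<le> r" for r
    by (rule fixed_point_unique[OF V(1) W(1) b _ _ that order_refl]) (auto intro: V W)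
  have "slope_u V r = slope_u W r" if "0 \<le> r" for r
  proof -
    have "integral {0..r} (\<lambda>s. s powr \<kappa> * source_u V s) = integral {0..r} (\<lambda>s. s powr \<kappa> * source_u W s)"
      by (rule Henstock_Kurzweil_Integration.integral_cong) (simp add: source_u_def eq)
    then show ?thesis by (simp add: slope_u_def wmean_def)
  qed
  then have "integral {0..norm x} (slope_u V) = integral {0..norm x} (slope_u W)" for x :: "real^'n"
    by (intro Henstock_Kurzweil_Integration.integral_cong) simp
  then show ?thesis by (simp add: V(3,4) W(3,4) eq)
qed

end

lemma C2_radial_solution_imp_radial_solution:
  "C2_radial_solution p m q \<alpha> \<beta> u v \<Longrightarrow> radial_solution p m q \<alpha> \<beta> u v"
  by (auto simp: C2_radial_solution_def radial_solution_def C2_on_def C1_on_def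
      intro: continuous_on_subset)

lemma ex1_pairI:
  assumes "P x y" and "\<And>s t. P s t \<Longrightarrow> s = x \<and> t = y"
  shows "\<exists>!(s, t). P s t"
proof (rule ex1I[of _ "(x, y)"])
  show "case (x, y) of (s, t) \<Rightarrow> P s t" using assms(1) by simp
  show "z = (x, y)" if "case z of (s, t) \<Rightarrow> P s t" for z
    using assms(2)[of "fst z" "snd z"] that by (simp add: case_prod_beta prod_eq_iff)
qed

theorem theorem1p4:
  fixes p m q \<alpha> \<beta> a b :: real
  assumes "CARD('n::finite) \<ge> 2"
    and "1 < p" "p < real CARD('n)"
    and "m > 0" "q > 0"
    and "0 \<le> \<alpha>" "\<alpha> < p - 1"
    and "0 \<le> \<beta>" "\<beta> \<le> m"
    and "(p - 1 - \<alpha>) * (p - 1 - \<beta>) - q * m > 0"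
    and "a > 0" "b > 0"
  shows "(\<exists>!(u, v). radial_solution p m q \<alpha> \<beta> (u :: real^'n \<Rightarrow> real) v \<and> u 0 = a \<and> v 0 = b) \<and>
         (p - 2 \<le> \<alpha> \<and> (p - 2) * (p - 1 - \<alpha>) \<le> q \<longrightarrow>
           (\<exists>!(u, v). C2_radial_solution p m q \<alpha> \<beta> (u :: real^'n \<Rightarrow> real) v \<and> u 0 = a \<and> v 0 = b))"
proof -
  define \<nu> where "\<nu> = real CARD('n) - 1"
  interpret system_exponents p m q \<alpha> \<beta> \<nu>
    using assms by unfold_locales (auto simp: \<nu>_def)
  obtain V where V: "admissible V" "\<And>r. 0 \<le> r \<Longrightarrow> V r = integral_op b V r"
    using fixed_point_global[OF \<open>b > 0\<close>] by blast
  define u :: "real^'n \<Rightarrow> real" where "u = (\<lambda>x. profile_u a V (norm x))"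
  define v :: "real^'n \<Rightarrow> real" where "v = (\<lambda>x. V (norm x))"
  note from_fixed_point = fixed_point_imp_solution[OF V(1) \<open>a > 0\<close> \<open>b > 0\<close> _ \<nu>_def, folded v_def]
  have "radial_solution p m q \<alpha> \<beta> u v"
    unfolding u_def by (intro from_fixed_point(1) V(2))
  moreover have "u 0 = a" by (simp add: u_def profile_u_def)
  moreover have "v 0 = b" using V(2)[of 0] by (simp add: v_def integral_op_def)
  ultimately have sol: "radial_solution p m q \<alpha> \<beta> u v" "u 0 = a" "v 0 = b" .
  have unique: "s = u \<and> t = v"
    if "radial_solution p m q \<alpha> \<beta> s t" "s 0 = a" "t 0 = b" for s t :: "real^'n \<Rightarrow> real"
    by (rule solution_unique[OF \<nu>_def \<open>b > 0\<close> that sol])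
  show ?thesis
  proof (intro conjI impI)
    show "\<exists>!(u, v). radial_solution p m q \<alpha> \<beta> (u :: real^'n \<Rightarrow> real) v \<and> u 0 = a \<and> v 0 = b"
    proof (rule ex1_pairI)
      show "radial_solution p m q \<alpha> \<beta> u v \<and> u 0 = a \<and> v 0 = b" using sol by blast
    qed (use unique in blast)
    assume C2: "p - 2 \<le> \<alpha> \<and> (p - 2) * (p - 1 - \<alpha>) \<le> q"
    have "C2_radial_solution p m q \<alpha> \<beta> u v"
      unfolding u_def using C2 by (intro from_fixed_point(4) V(2)) auto
    then show "\<exists>!(u, v). C2_radial_solution p m q \<alpha> \<beta> (u :: real^'n \<Rightarrow> real) v \<and> u 0 = a \<and> v 0 = b"
    proof (intro ex1_pairI)
      assume "C2_radial_solution p m q \<alpha> \<beta> u v"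
      then show "C2_radial_solution p m q \<alpha> \<beta> u v \<and> u 0 = a \<and> v 0 = b" using sol by blast
    qed (use unique C2_radial_solution_imp_radial_solution in blast)
  qed
qed

end
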